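(* Let $G$ be a finite graph satisfying the standing assumptions of the context. Let $W$ denote the set of those vertices $i \in V(G)$ such that $G$ has no loop at $i$, and let $G'$ be the induced subgraph of $G$ on $W$. Then the following conditions are equivalent: (i) $\mathcal{P}_G$ is simple, but not a simplex; (ii) $\mathcal{P}_G$ is smooth, but not a simplex; (iii) $W \neq \emptyset$ and $G$ is one of the following graphs: ($\alpha$) $G$ is a complete bipartite graph with at least one cycle of length $4$; ($\beta$) $G$ has exactly one loop, $G'$ is a complete bipartite graph, and if $G$ has a loop at $i$, then $\{i,j\} \in E(G)$ for all $j \in W$; ($\gamma$) $G$ has at least two loops, $G'$ has no edge, and if $G$ has a loop at $i$, then $\{i,j\} \in E(G)$ for all $j \in W$.
   Context: Standing assumptions: $G$ is a finite graph on the vertex set $V(G)=\{1,\dots,d\}$, allowing loops, having no multiple edge and no isolated vertex (a vertex carrying a loop is not isolated); $E(G)$ is its set of edges and loops, a loop at $i$ being written $\{i,i\}$. Moreover $G$ satisfies condition $( * )$: if $i,j\in V(G)$ and $G$ has a loop at each of $i$ and $j$, then $\{i,j\}\in E(G)$. Edge polytope: for $e=\{i,j\}\in E(G)$ put $\rho(e)=\mathbf{e}_i+\mathbf{e}_j\in\mathbb{R}^d$, where $\mathbf{e}_i$ is the $i$th unit coordinate vector (so $\rho(\{i,i\})=2\mathbf{e}_i$). The edge polytope $\mathcal{P}_G\subset\mathbb{R}^d$ is the convex hull of $\{\rho(e) : e\in E(G)\}$. Induced subgraph: for $U\subset V(G)$, the induced subgraph on $U$ has vertex set $U$ and as edges all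 $\{i,j\}\in E(G)$ (loops included) with $i,j\in U$. A bipartite graph is one whose vertex set decomposes as $V_1\cup V_2$ (disjoint) with every edge having one endpoint in each part (in particular it has no loop); it is complete bipartite if $V_1, V_2$ are nonempty and all $\{i,j\}$ with $i\in V_1$, $j\in V_2$ are edges. A convex polytope of dimension $\delta$ is simple if each of its vertices belongs to exactly $\delta$ edges of the polytope. A simple polytope with integral vertices is smooth if at each vertex the primitive edge directions form a lattice basis; here the lattice is the one generated by the differences of the points of $\mathcal{P}_G\cap\mathbb{Z}^d$, and the primitive edge direction along an edge at a vertex $v$ is the shortest nonzero vector of this lattice pointing from $v$ along that edge. *)

theory Defs
  imports "HOL-Analysis.Analysis"
begin

text \<open>
  A finite graph, with loops allowed and without multiple edges, is given by a vertex set and a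
  set \<open>E\<close> of edges and loops, each of the form \<open>{i, j}\<close>; a loop at \<open>i\<close> is \<open>{i, i}\<close>, i.e. the
  singleton \<open>{i}\<close>. The vertices \<open>1, \<dots>, d\<close> are the elements of a finite index type \<open>'n\<close>, so that the
  ambient space of the edge polytope is \<open>real ^ 'n\<close>.
\<close>

definition induced_edges :: "'v set set \<Rightarrow> 'v set \<Rightarrow> 'v set set" where
  "induced_edges E U = {{i, j} | i j. {i, j} \<in> E \<and> i \<in> U \<and> j \<in> U}"

definition complete_bipartite :: "'v set \<Rightarrow> 'v set set \<Rightarrow> bool" where
  "complete_bipartite V E \<longleftrightarrow>
     (\<exists>V1 V2. V1 \<union> V2 = V \<and> V1 \<inter> V2 = {} \<and> V1 \<noteq> {} \<and> V2 \<noteq> {} \<and>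
        (\<forall>e\<in>E. \<exists>i\<in>V1. \<exists>j\<in>V2. e = {i, j}) \<and>
        (\<forall>i\<in>V1. \<forall>j\<in>V2. {i, j} \<in> E))"

definition is_cycle :: "'v set set \<Rightarrow> 'v list \<Rightarrow> bool" where
  "is_cycle E vs \<longleftrightarrow>
     3 \<le> length vs \<and> distinct vs \<and>
     (\<forall>k<length vs. {vs ! k, vs ! (Suc k mod length vs)} \<in> E)"

definition edge_polytope :: "'n::finite set set \<Rightarrow> (real ^ 'n) set" where
  "edge_polytope E = convex hull {axis i 1 + axis j 1 | i j. {i, j} \<in> E}"

definition simple_polytope :: "'a::euclidean_space set \<Rightarrow> bool" where
  "simple_polytope P \<longleftrightarrow>
     polytope P \<and>
     (\<forall>v. v extreme_point_of P \<longrightarrow> int (card {F. F edge_of P \<and> v \<in> F}) = aff_dim P)"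

definition is_simplex :: "'a::euclidean_space set \<Rightarrow> bool" where
  "is_simplex P \<longleftrightarrow> (\<exists>k. k simplex P)"

definition integral_points :: "(real ^ 'n) set" where
  "integral_points = {x. \<forall>i. x $ i \<in> \<int>}"

text \<open>\<open>real ^ 'n\<close> as a \<open>\<int>\<close>-module; its submodule spans are the additive subgroups generated by sets
  of vectors, and independence is linear independence over \<open>\<int>\<close>.\<close>

definition int_scale :: "int \<Rightarrow> real ^ 'n \<Rightarrow> real ^ 'n" where
  "int_scale k x = of_int k *\<^sub>R x"

interpretation int_vec: module "int_scale :: int \<Rightarrow> real ^ 'n \<Rightarrow> real ^ 'n"
  by unfold_locales (simp_all add: int_scale_def algebra_simps)

definition polytope_lattice :: "(real ^ 'n) set \<Rightarrow> (real ^ 'n) set" where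
  "polytope_lattice P =
     int_vec.span {x - y | x y. x \<in> P \<inter> integral_points \<and> y \<in> P \<inter> integral_points}"

definition lattice_basis :: "(real ^ 'n) set \<Rightarrow> (real ^ 'n) set \<Rightarrow> bool" where
  "lattice_basis B L \<longleftrightarrow> int_vec.independent B \<and> int_vec.span B = L"

definition along_edge :: "(real ^ 'n) set \<Rightarrow> real ^ 'n \<Rightarrow> real ^ 'n \<Rightarrow> bool" where
  "along_edge F v u \<longleftrightarrow> u \<noteq> 0 \<and> (\<exists>t>0. v + t *\<^sub>R u \<in> F)"

definition primitive_direction ::
    "(real ^ 'n) set \<Rightarrow> (real ^ 'n) set \<Rightarrow> real ^ 'n \<Rightarrow> real ^ 'n \<Rightarrow> bool" where
  "primitive_direction L F v u \<longleftrightarrow>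
     u \<in> L \<and> along_edge F v u \<and> (\<forall>w\<in>L. along_edge F v w \<longrightarrow> norm u \<le> norm w)"

definition smooth_polytope :: "(real ^ 'n) set \<Rightarrow> bool" where
  "smooth_polytope P \<longleftrightarrow>
     simple_polytope P \<and>
     (\<forall>v. v extreme_point_of P \<longrightarrow>
        v \<in> integral_points \<and>
        lattice_basis
          {u. \<exists>F. F edge_of P \<and> v \<in> F \<and> primitive_direction (polytope_lattice P) F v u}
          (polytope_lattice P))"

end

theory Submission
  imports Defs
begin

text \<open>
  Write \<open>\<rho>(e)\<close> for the point of an edge or loop \<open>e\<close>; the edge polytope \<open>P\<close> is the convex hull of
  these points.

  \<^bold>\<open>Vertices of a polytope.\<close> At a vertex \<open>v\<close> choose a minimal set \<open>B\<close> of vectors that generates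
  the cone spanned by \<open>P - v\<close>. The edges of \<open>P\<close> at \<open>v\<close> are then exactly the rays from \<open>v\<close> along
  the elements of \<open>B\<close>, so \<open>v\<close> lies on \<open>dim P\<close> edges iff \<open>B\<close> is linearly independent. This is
  used in both directions. If \<open>P\<close> is simple, the differences \<open>t - v\<close> to the points \<open>t\<close> joined to
  \<open>v\<close> by an edge are independent (\<open>simple_vertex_edges_independent\<close>); hence such points satisfy
  no affine relation, and \<open>P\<close> is a simplex as soon as \<open>v\<close> is joined to all other vertices.
  Conversely, let the generators be all the integral points of \<open>P\<close>; if \<open>B\<close> is an independent set
  of vectors leading from \<open>v\<close> to generators, and every generator is \<open>v\<close> plus a sum of elements
  of \<open>B\<close>, then \<open>v\<close> is a simple vertex, its primitive edge directions are the elements of \<open>B\<close>,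
  and they form a lattice basis (\<open>unimodular_vertex\<close>).

  \<^bold>\<open>From the graphs to smoothness.\<close> Cases \<open>(\<alpha>)\<close> and \<open>(\<beta>)\<close> have a common form (\<open>biclique\<close>): two
  sets \<open>X\<close> and \<open>Y\<close> of graph vertices cover everything and share at most one element, and the
  edges are the pairs \<open>{x, y}\<close> with \<open>x \<in> X\<close> and \<open>y \<in> Y\<close>. A common element carries the only loop.
  The polytope is a product of two simplices. In case \<open>(\<gamma>)\<close> it is a simplex with the face
  spanned by the loopless vertices cut off (\<open>truncated\<close>). In both cases the sets \<open>B\<close> can be
  written down and consist of differences of unit vectors.

  \<^bold>\<open>From simplicity to the graphs.\<close> Assigning weights to the graph vertices defines a linear
  functional on \<open>P\<close>. If it vanishes at \<open>\<rho>(e)\<close> and \<open>\<rho>(f)\<close> and is positive at all other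
  generators, the segment from \<open>\<rho>(e)\<close> to \<open>\<rho>(f)\<close> is an edge of \<open>P\<close>. (The point of an edge between
  two looped vertices is a midpoint of two generators and can be left out.) Six such weightings
  suffice. If \<open>P\<close> is not a simplex, some pair of generators is not joined, and then these
  weightings fail for the pair; this forces \<open>G\<close> to contain a \<open>4\<close>-cycle, or a loop \<open>l\<close> together
  with a triangle \<open>l a b\<close> on it and two loopless vertices, or two loops with a common loopless
  neighbour. Each configuration carries four generators with an affine relation: a square \<open>\<rho>(ij)
  + \<rho>(kl) = \<rho>(il) + \<rho>(kj)\<close> or a trapezoid \<open>\<rho>(ll) + 2 \<rho>(mw) = \<rho>(mm) + 2 \<rho>(lw)\<close>. If a further
  graph vertex were attached to the configuration in any way not occurring in \<open>(\<alpha>)\<close>, \<open>(\<beta>)\<close> or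
  \<open>(\<gamma>)\<close>, the weightings would join a single generator to affinely related ones, which a simple
  polytope forbids. So all adjacencies are determined.
\<close>

section \<open>Nonnegative combinations\<close>

definition pos_span :: "'a::real_vector set \<Rightarrow> 'a set" where
  "pos_span B = {(\<Sum>b\<in>B. c b *\<^sub>R b) | c. \<forall>b\<in>B. 0 \<le> c b}"

lemma pos_spanI: "(\<And>b. b \<in> B \<Longrightarrow> 0 \<le> c b) \<Longrightarrow> x = (\<Sum>b\<in>B. c b *\<^sub>R b) \<Longrightarrow> x \<in> pos_span B"
  unfolding pos_span_def by blast

lemma pos_spanE:
  assumes "x \<in> pos_span B"
  obtains c where "\<And>b. b \<in> B \<Longrightarrow> 0 \<le> c b" "x = (\<Sum>b\<in>B. c b *\<^sub>R b)"
  using assms unfolding pos_span_def by blast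

lemma pos_span_zero: "0 \<in> pos_span B"
  by (rule pos_spanI[of _ "\<lambda>_. 0"]) auto

lemma pos_span_add:
  assumes "x \<in> pos_span B" "y \<in> pos_span B"
  shows "x + y \<in> pos_span B"
proof -
  obtain c where c: "\<And>b. b \<in> B \<Longrightarrow> 0 \<le> c b" "x = (\<Sum>b\<in>B. c b *\<^sub>R b)"
    using assms(1) pos_spanE by blast
  obtain d where d: "\<And>b. b \<in> B \<Longrightarrow> 0 \<le> d b" "y = (\<Sum>b\<in>B. d b *\<^sub>R b)"
    using assms(2) pos_spanE by blast
  show ?thesis
    by (rule pos_spanI[of _ "\<lambda>b. c b + d b"])
      (simp_all add: c d scaleR_add_left sum.distrib)
qed

lemma pos_span_scale:
  assumes "x \<in> pos_span B" "0 \<le> t"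
  shows "t *\<^sub>R x \<in> pos_span B"
proof -
  obtain c where "\<And>b. b \<in> B \<Longrightarrow> 0 \<le> c b" "x = (\<Sum>b\<in>B. c b *\<^sub>R b)"
    using assms(1) by (metis pos_spanE)
  then show ?thesis
    using assms(2) by (intro pos_spanI[of _ "\<lambda>b. t * c b"]) (auto simp: scaleR_sum_right)
qed

lemma pos_span_base:
  assumes "finite B" "b \<in> B"
  shows "b \<in> pos_span B"
proof -
  have "(\<Sum>x\<in>B. (if x = b then 1 else 0) *\<^sub>R x) = (\<Sum>x\<in>B. if x = b then b else 0)"
    by (rule sum.cong) auto
  also have "\<dots> = b"
    using assms by simp
  finally show ?thesis
    using pos_spanI[of B "\<lambda>x. if x = b then 1 else 0" b] by simp
qed

lemma pos_span_sum:
  assumes "\<And>i. i \<in> I \<Longrightarrow> 0 \<le> c i" "\<And>i. i \<in> I \<Longrightarrow> f i \<in> pos_span B"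
  shows "(\<Sum>i\<in>I. c i *\<^sub>R f i) \<in> pos_span B"
proof (cases "finite I")
  case True
  then show ?thesis using assms
    by (induction I rule: finite_induct) (simp_all add: pos_span_zero pos_span_add pos_span_scale)
qed (simp add: pos_span_zero)

lemma pos_span_minimal:
  assumes "A \<subseteq> pos_span B"
  shows "pos_span A \<subseteq> pos_span B"
proof
  fix x assume "x \<in> pos_span A"
  then obtain c where c: "\<And>b. b \<in> A \<Longrightarrow> 0 \<le> c b" "x = (\<Sum>b\<in>A. c b *\<^sub>R b)"
    using pos_spanE[of x A] by blast
  show "x \<in> pos_span B"
    unfolding c(2) using assms c(1) by (intro pos_span_sum) auto
qed

lemma pos_span_subset_span: "pos_span B \<subseteq> span B"
  unfolding pos_span_def by (auto intro!: span_sum span_scale intro: span_base)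

lemma convex_hull_minus_in_pos_span:
  assumes "\<And>s. s \<in> S \<Longrightarrow> s - v \<in> pos_span B" "x \<in> convex hull S"
  shows "x - v \<in> pos_span B"
proof -
  have "convex {x. x - v \<in> pos_span B}"
  proof (rule convexI)
    fix x y and u t :: real
    assume *: "x \<in> {x. x - v \<in> pos_span B}" "y \<in> {x. x - v \<in> pos_span B}" "0 \<le> u" "0 \<le> t" "u + t = 1"
    have "u *\<^sub>R x + t *\<^sub>R y - (u + t) *\<^sub>R v = u *\<^sub>R (x - v) + t *\<^sub>R (y - v)"
      by (simp add: algebra_simps)
    then have "u *\<^sub>R x + t *\<^sub>R y - v = u *\<^sub>R (x - v) + t *\<^sub>R (y - v)"
      by (simp add: \<open>u + t = 1\<close>)
    then show "u *\<^sub>R x + t *\<^sub>R y \<in> {x. x - v \<in> pos_span B}"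
      using * by (auto intro: pos_span_add pos_span_scale)
  qed
  then have "convex hull S \<subseteq> {x. x - v \<in> pos_span B}"
    using assms(1) by (intro hull_minimal) auto
  then show ?thesis using assms(2) by auto
qed

text \<open>
  The cone at an extreme point contains no line: a vanishing nonnegative combination of the
  vectors \<open>b\<close>, scaled to total weight one, would exhibit \<open>v\<close> as a convex combination of points
  of \<open>P - {v}\<close>, which is a convex set.
\<close>

lemma extreme_point_pointed:
  assumes P: "convex P" "v extreme_point_of P"
    and B: "finite B" "\<And>b. b \<in> B \<Longrightarrow> v + b \<in> P" "\<And>b. b \<in> B \<Longrightarrow> b \<noteq> 0"
    and c: "\<And>b. b \<in> B \<Longrightarrow> 0 \<le> c b" "(\<Sum>b\<in>B. c b *\<^sub>R b) = 0" and b: "b \<in> B"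
  shows "c b = 0"
proof (rule ccontr)
  assume "c b \<noteq> 0"
  define C where "C = sum c B"
  have C: "C > 0"
    unfolding C_def using \<open>c b \<noteq> 0\<close> c(1)[OF b] c(1) by (intro sum_pos2[OF B(1) b]) auto
  have "convex (P - {v})"
    using P extreme_point_of_stillconvex by blast
  moreover have one: "(\<Sum>b\<in>B. c b / C) = 1"
    using C by (simp add: C_def flip: sum_divide_distrib)
  moreover have "v + b \<in> P - {v}" if "b \<in> B" for b
    using B(2,3)[OF that] by simp
  moreover have "0 \<le> c b / C" if "b \<in> B" for b
    using c(1)[OF that] C by simp
  ultimately have "(\<Sum>b\<in>B. (c b / C) *\<^sub>R (v + b)) \<in> P - {v}"
    using convex_sum[OF B(1), of "P - {v}" "\<lambda>b. c b / C" "\<lambda>b. v + b"] by blast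
  moreover have "(\<Sum>b\<in>B. (c b / C) *\<^sub>R (v + b)) = v"
  proof -
    have "(\<Sum>b\<in>B. (c b / C) *\<^sub>R (v + b)) = (\<Sum>b\<in>B. (c b / C) *\<^sub>R v + (1 / C) *\<^sub>R (c b *\<^sub>R b))"
      by (rule sum.cong) (simp_all add: scaleR_add_right)
    also have "\<dots> = (\<Sum>b\<in>B. c b / C) *\<^sub>R v + (1 / C) *\<^sub>R (\<Sum>b\<in>B. c b *\<^sub>R b)"
      unfolding sum.distrib scaleR_left.sum scaleR_sum_right ..
    finally show ?thesis
      unfolding one c(2) by simp
  qed
  ultimately show False
    by simp
qed

section \<open>Edges of a polytope at a vertex\<close>

definition ray :: "'a::real_vector \<Rightarrow> 'a \<Rightarrow> 'a set" where
  "ray v b = {v + t *\<^sub>R b | t. 0 \<le> t}"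

lemma base_in_ray: "v \<in> ray v b"
  unfolding ray_def by (rule CollectI, rule exI[of _ 0]) simp

lemma tip_in_ray: "v + b \<in> ray v b"
  unfolding ray_def by (rule CollectI, rule exI[of _ 1]) simp

text \<open>
  A polytope seen from one of its vertices: \<open>B\<close> is an irredundant set of generators of the cone
  spanned by \<open>P - v\<close>, scaled so that their tips stay in \<open>P\<close>.
\<close>

locale vertex_cone =
  fixes P :: "'a::euclidean_space set" and v :: 'a and B :: "'a set"
  assumes polytope: "polytope P"
    and vertex: "v extreme_point_of P"
    and finite_B: "finite B"
    and tips: "\<And>b. b \<in> B \<Longrightarrow> v + b \<in> P"
    and covers: "\<And>x. x \<in> P \<Longrightarrow> x - v \<in> pos_span B"
    and irredundant: "\<And>b. b \<in> B \<Longrightarrow> b \<notin> pos_span (B - {b})"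
begin

lemma convex_P: "convex P"
  using polytope polytope_imp_convex by blast

lemma v_in_P: "v \<in> P"
  using vertex by (simp add: extreme_point_of_def)

lemma generator_nonzero: "b \<in> B \<Longrightarrow> b \<noteq> 0"
  using irredundant pos_span_zero by blast

text \<open>
  Every generator spans an extreme ray of the cone. In a combination equal to \<open>t b\<close>, either the
  coefficient of \<open>b\<close> is below \<open>t\<close>, and \<open>b\<close> is a combination of the others; or moving \<open>t b\<close> to
  the other side leaves a vanishing nonnegative combination.
\<close>

lemma ray_coefficients:
  assumes b: "b \<in> B" and c: "\<And>b. b \<in> B \<Longrightarrow> 0 \<le> c b" and eq: "(\<Sum>b\<in>B. c b *\<^sub>R b) = t *\<^sub>R b"
    and b': "b' \<in> B" "b' \<noteq> b"
  shows "c b' = 0"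
proof -
  have split: "(\<Sum>b\<in>B. c b *\<^sub>R b) = c b *\<^sub>R b + (\<Sum>b\<in>B - {b}. c b *\<^sub>R b)"
    using b finite_B by (simp add: sum.remove)
  show ?thesis
  proof (cases "c b < t")
    case True
    have "(\<Sum>b\<in>B - {b}. c b *\<^sub>R b) \<in> pos_span (B - {b})"
      using c by (intro pos_spanI[of _ c]) auto
    then have "(1 / (t - c b)) *\<^sub>R (\<Sum>b\<in>B - {b}. c b *\<^sub>R b) \<in> pos_span (B - {b})"
      using True by (intro pos_span_scale) auto
    moreover have "(\<Sum>b\<in>B - {b}. c b *\<^sub>R b) = (t - c b) *\<^sub>R b"
      using eq split by (simp add: algebra_simps)
    ultimately show ?thesis
      using True irredundant[OF b] by simp
  next
    case False
    define d where "d = c(b := c b - t)"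
    have "(\<Sum>b\<in>B. d b *\<^sub>R b) = (c b - t) *\<^sub>R b + (\<Sum>b\<in>B - {b}. c b *\<^sub>R b)"
      using b finite_B by (simp add: d_def sum.remove)
    also have "\<dots> = 0"
      using eq split by (simp add: algebra_simps)
    finally have "d b' = 0"
      using False c b'
      by (intro extreme_point_pointed[OF convex_P vertex finite_B tips generator_nonzero])
        (auto simp: d_def)
    then show ?thesis
      using b' by (simp add: d_def)
  qed
qed

lemma ray_face:
  assumes b: "b \<in> B"
  shows "P \<inter> ray v b face_of P"
proof -
  have cvx: "convex (P \<inter> ray v b)"
  proof (rule convex_Int[OF convex_P], rule convexI)
    fix x y and u t :: real
    assume *: "x \<in> ray v b" "y \<in> ray v b" "0 \<le> u" "0 \<le> t" "u + t = 1"
    then obtain r s where rs: "x = v + r *\<^sub>R b" "y = v + s *\<^sub>R b" "0 \<le> r" "0 \<le> s"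
      by (auto simp: ray_def)
    have "u *\<^sub>R x + t *\<^sub>R y = (u + t) *\<^sub>R v + (u * r + t * s) *\<^sub>R b"
      unfolding rs(1,2) by (simp add: algebra_simps)
    then have "u *\<^sub>R x + t *\<^sub>R y = v + (u * r + t * s) *\<^sub>R b"
      by (simp add: \<open>u + t = 1\<close>)
    then show "u *\<^sub>R x + t *\<^sub>R y \<in> ray v b"
      using * rs(3,4) unfolding ray_def by (intro CollectI exI[of _ "u * r + t * s"]) simp
  qed
  moreover have "x \<in> ray v b \<and> y \<in> ray v b"
    if xy: "x \<in> P" "y \<in> P" and p: "p \<in> ray v b" "p \<in> open_segment x y" for x y p
  proof -
    obtain c where c: "\<And>b. b \<in> B \<Longrightarrow> 0 \<le> c b" "x - v = (\<Sum>b\<in>B. c b *\<^sub>R b)"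
      using pos_spanE[OF covers[OF xy(1)]] by blast
    obtain d where d: "\<And>b. b \<in> B \<Longrightarrow> 0 \<le> d b" "y - v = (\<Sum>b\<in>B. d b *\<^sub>R b)"
      using pos_spanE[OF covers[OF xy(2)]] by blast
    obtain u where u: "0 < u" "u < 1" "p = (1 - u) *\<^sub>R x + u *\<^sub>R y"
      using p(2) by (auto simp: in_segment)
    obtain t where t: "0 \<le> t" "p = v + t *\<^sub>R b"
      using p(1) by (auto simp: ray_def)
    have "t *\<^sub>R b = p - v"
      by (simp add: t(2))
    also have "\<dots> = (1 - u) *\<^sub>R (x - v) + u *\<^sub>R (y - v)"
      unfolding u(3) by (simp add: algebra_simps)
    also have "\<dots> = (\<Sum>b\<in>B. ((1 - u) * c b + u * d b) *\<^sub>R b)"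
      unfolding c(2) d(2) by (simp add: scaleR_add_left sum.distrib scaleR_sum_right)
    finally have eq: "(\<Sum>b\<in>B. ((1 - u) * c b + u * d b) *\<^sub>R b) = t *\<^sub>R b" ..
    have zero: "c b' = 0 \<and> d b' = 0" if "b' \<in> B" "b' \<noteq> b" for b'
    proof -
      have "(1 - u) * c b' + u * d b' = 0"
        using ray_coefficients[OF b _ eq that] u c(1) d(1) by auto
      moreover have "0 \<le> (1 - u) * c b'" "0 \<le> u * d b'"
        using u c(1) d(1) that by auto
      ultimately have "(1 - u) * c b' = 0" "u * d b' = 0" by linarith+
      then show ?thesis using u by auto
    qed
    have only_b: "(\<Sum>b\<in>B. e b *\<^sub>R b) = e b *\<^sub>R b" if "\<And>b'. b' \<in> B \<Longrightarrow> b' \<noteq> b \<Longrightarrow> e b' = 0" for e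
      using that b finite_B by (simp add: sum.remove)
    have "x - v = c b *\<^sub>R b" "y - v = d b *\<^sub>R b"
      using c(2) d(2) only_b[of c] only_b[of d] zero by auto
    then have "x = v + c b *\<^sub>R b" "y = v + d b *\<^sub>R b"
      by (simp_all add: algebra_simps)
    then show ?thesis
      using c(1)[OF b] d(1)[OF b] by (auto simp: ray_def)
  qed
  ultimately show ?thesis
    unfolding face_of_def by blast
qed

lemma ray_edge:
  assumes b: "b \<in> B"
  shows "P \<inter> ray v b edge_of P"
proof -
  have ne: "v \<noteq> v + b"
    using generator_nonzero[OF b] by simp
  have "{v, v + b} \<subseteq> P \<inter> ray v b"
    using v_in_P tips[OF b] base_in_ray tip_in_ray by auto
  moreover have "P \<inter> ray v b \<subseteq> affine hull {v, v + b}"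
    by (auto simp: affine_hull_2_alt ray_def)
  ultimately have "aff_dim (P \<inter> ray v b) = aff_dim {v, v + b}"
    by (metis aff_dim_affine_hull aff_dim_subset antisym)
  then show ?thesis
    using ray_face[OF b] ne by (simp add: edge_of_def aff_dim_2)
qed

text \<open>
  An edge \<open>F\<close> at \<open>v\<close> is exposed by a functional \<open>h\<close>. Expanding a second point of \<open>F\<close> in the
  generators, \<open>h\<close> has to vanish on each generator that occurs, so \<open>F\<close> contains the tip of one of
  them and is the part of \<open>P\<close> on the line through \<open>v\<close> and that tip. Points beyond \<open>v\<close> are
  excluded since \<open>v\<close> is extreme.
\<close>

lemma edge_is_ray:
  assumes F: "F edge_of P" "v \<in> F"
  shows "\<exists>b\<in>B. F = P \<inter> ray v b"
proof -
  have face: "F face_of P" and dim: "aff_dim F = 1"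
    using F by (auto simp: edge_of_def)
  have "F \<noteq> {v}"
    using dim by auto
  then obtain w where w: "w \<in> F" "w \<noteq> v"
    using F(2) by auto
  have "F exposed_face_of P"
    using exposed_face_of_polyhedron face polytope polytope_imp_polyhedron by blast
  then obtain h \<beta> where h: "P \<subseteq> {x. h \<bullet> x \<le> \<beta>}" "F = P \<inter> {x. h \<bullet> x = \<beta>}"
    by (auto simp: exposed_face_of_def)
  then obtain c where c: "\<And>b. b \<in> B \<Longrightarrow> 0 \<le> c b" "w - v = (\<Sum>b\<in>B. c b *\<^sub>R b)"
    using w covers by (metis IntD1 pos_spanE)
  then obtain b where b: "b \<in> B" "c b \<noteq> 0"
    using w(2) by (metis (no_types, lifting) eq_iff_diff_eq_0 scaleR_zero_left sum.neutral)
  have le: "h \<bullet> b \<le> 0" if "b \<in> B" for b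
    using h F(2) tips[OF that] by (force simp: inner_add_right)
  have "(\<Sum>b\<in>B. c b * (h \<bullet> b)) = h \<bullet> (w - v)"
    by (simp add: c(2) inner_sum_right)
  also have "\<dots> = 0"
    using h w(1) F(2) by (simp add: inner_diff_right)
  finally have "(\<Sum>b\<in>B. - (c b * (h \<bullet> b))) = 0"
    by (simp add: sum_negf)
  then have "c b * (h \<bullet> b) = 0"
    using sum_nonneg_0[OF finite_B _ _ b(1), of "\<lambda>b. - (c b * (h \<bullet> b))"] c(1) le
    by (simp add: mult_nonneg_nonpos)
  then have tip: "v + b \<in> F"
    using h F(2) tips b by (auto simp: inner_add_right)
  have ne: "v \<noteq> v + b"
    using generator_nonzero[OF b(1)] by simp
  have "affine hull {v, v + b} = affine hull F"
  proof (rule affine_dim_equal)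
    show "affine hull {v, v + b} \<subseteq> affine hull F"
      using tip F(2) by (intro hull_mono) auto
    show "aff_dim (affine hull {v, v + b}) = aff_dim (affine hull F)"
      using ne dim by (simp add: aff_dim_2)
  qed auto
  then have Fline: "F = P \<inter> range (\<lambda>t. v + t *\<^sub>R b)"
    using face_of_imp_eq_affine_Int[OF convex_P face] by (auto simp: affine_hull_2_alt)
  have "0 \<le> t" if t: "v + t *\<^sub>R b \<in> P" for t
  proof (rule ccontr)
    assume "\<not> 0 \<le> t"
    then have neg: "t < 0" by simp
    \<comment> \<open>the ratio in which \<open>v\<close> divides the segment from \<open>v + t b\<close> to \<open>v + b\<close>\<close>
    define u where "u = - t / (1 - t)"
    have u: "0 < u" "u < 1" "(1 - u) * t + u = 0"
      using neg by (auto simp: u_def field_simps)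
    have "(1 - u) *\<^sub>R (v + t *\<^sub>R b) + u *\<^sub>R (v + b) = v + ((1 - u) * t + u) *\<^sub>R b"
      by (simp add: algebra_simps)
    then have "v = (1 - u) *\<^sub>R (v + t *\<^sub>R b) + u *\<^sub>R (v + b)"
      by (simp add: u(3))
    moreover have "v + t *\<^sub>R b \<noteq> v + b"
    proof
      assume "v + t *\<^sub>R b = v + b"
      then have "(t - 1) *\<^sub>R b = 0"
        by (simp add: algebra_simps)
      then show False
        using neg generator_nonzero[OF b(1)] by simp
    qed
    ultimately have "v \<in> open_segment (v + t *\<^sub>R b) (v + b)"
      unfolding in_segment using u by blast
    then show False
      using vertex t tips[OF b(1)] by (auto simp: extreme_point_of_def)
  qed
  then have "F = P \<inter> ray v b"
    unfolding Fline ray_def by auto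
  then show ?thesis using b by blast
qed

lemma edges_at_vertex: "{F. F edge_of P \<and> v \<in> F} = (\<lambda>b. P \<inter> ray v b) ` B"
proof -
  have "v \<in> P \<inter> ray v b" for b
    using v_in_P base_in_ray by blast
  then show ?thesis
    using ray_edge edge_is_ray by blast
qed

lemma inj_on_ray: "inj_on (\<lambda>b. P \<inter> ray v b) B"
proof (rule inj_onI, rule ccontr)
  fix b b' assume *: "b \<in> B" "b' \<in> B" "P \<inter> ray v b = P \<inter> ray v b'" "b \<noteq> b'"
  have "v + b' \<in> ray v b"
    using * tips tip_in_ray by blast
  then obtain t where t: "0 \<le> t" "b' = t *\<^sub>R b"
    by (auto simp: ray_def)
  have "b \<in> pos_span (B - {b'})"
    using * finite_B by (intro pos_span_base) auto
  then have "b' \<in> pos_span (B - {b'})"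
    unfolding t(2) using t(1) by (rule pos_span_scale)
  then show False
    using irredundant * by blast
qed

lemma card_edges_at_vertex: "card {F. F edge_of P \<and> v \<in> F} = card B"
  by (simp add: edges_at_vertex card_image inj_on_ray)

lemma aff_dim_eq: "aff_dim P = int (dim B)"
proof -
  have "v \<in> affine hull P"
    using v_in_P by (simp add: hull_inc)
  moreover have "span ((\<lambda>x. x - v) ` P) = span B"
  proof (rule subset_antisym)
    show "span ((\<lambda>x. x - v) ` P) \<subseteq> span B"
      using covers pos_span_subset_span by (intro span_minimal) auto
    have "B \<subseteq> (\<lambda>x. x - v) ` P"
      using tips by (force intro: rev_image_eqI)
    then show "span B \<subseteq> span ((\<lambda>x. x - v) ` P)"
      by (rule span_mono)
  qed
  ultimately show ?thesis
    by (metis aff_dim_eq_dim_subtract dim_span)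
qed

end

text \<open>
  A generating set of least cardinality is irredundant.
\<close>

lemma vertex_cone_exists:
  fixes v :: "'a::euclidean_space"
  assumes S: "finite S" and v: "v extreme_point_of convex hull S"
  obtains B where "vertex_cone (convex hull S) v B" "B \<subseteq> (\<lambda>s. s - v) ` S - {0}"
proof -
  define good where
    "good B \<longleftrightarrow> B \<subseteq> (\<lambda>s. s - v) ` S - {0} \<and> (\<lambda>s. s - v) ` S \<subseteq> pos_span B" for B
  have "good ((\<lambda>s. s - v) ` S - {0})"
  proof -
    have "s - v \<in> pos_span ((\<lambda>s. s - v) ` S - {0})" if "s \<in> S" for s
      using S that by (cases "s = v") (auto intro!: pos_span_zero pos_span_base)
    then show ?thesis
      by (auto simp: good_def)
  qed
  then obtain B where B: "good B" and least: "\<And>A. good A \<Longrightarrow> card B \<le> card A"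
    using ex_has_least_nat[of good _ card] by blast
  have fin: "finite B"
    using B S finite_subset unfolding good_def by blast
  have "vertex_cone (convex hull S) v B"
  proof
    show "polytope (convex hull S)"
      using S by (rule polytope_convex_hull)
    show "v + b \<in> convex hull S" if "b \<in> B" for b
      using that B by (intro hull_inc) (auto simp: good_def)
    show "x - v \<in> pos_span B" if "x \<in> convex hull S" for x
      using convex_hull_minus_in_pos_span[of S v B x] B that unfolding good_def by blast
    show "b \<notin> pos_span (B - {b})" if "b \<in> B" for b
    proof
      assume "b \<in> pos_span (B - {b})"
      then have "B \<subseteq> pos_span (B - {b})"
        using fin pos_span_base[of "B - {b}"] by auto
      then have "good (B - {b})"
        using B pos_span_minimal[of B "B - {b}"] unfolding good_def by blast
      then show False
        using least fin that by (metis card_Diff1_less linorder_not_less)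
    qed
  qed (use v fin in auto)
  then show ?thesis
    using that B by (auto simp: good_def)
qed

section \<open>Simple vertices and simplices\<close>

lemma polytope_extreme_points:
  fixes P :: "'a::euclidean_space set"
  assumes "polytope P"
  shows "finite {x. x extreme_point_of P}" "P = convex hull {x. x extreme_point_of P}"
proof -
  show "finite {x. x extreme_point_of P}"
    using assms by (intro finite_polyhedron_extreme_points polytope_imp_polyhedron)
  obtain V where "finite V" "P = convex hull V"
    using assms by (auto simp: polytope_def)
  then show "P = convex hull {x. x extreme_point_of P}"
    using Krein_Milman_polytope by blast
qed

text \<open>
  As many generators of the cone at \<open>v\<close> as its dimension have to be independent. If the
  generators are taken among the differences to other vertices, an edge from \<open>v\<close> to \<open>t\<close> is the
  ray along some generator \<open>b\<close> whose tip is a vertex on that edge, so \<open>t - v\<close> is \<open>b\<close> itself.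
\<close>

lemma simple_vertex_edges_independent:
  fixes P :: "'a::euclidean_space set"
  assumes P: "simple_polytope P" and v: "v extreme_point_of P"
  shows "independent {t - v | t. closed_segment v t edge_of P}"
proof -
  define S where "S = {x. x extreme_point_of P}"
  have S: "finite S" "P = convex hull S"
    using P polytope_extreme_points unfolding simple_polytope_def S_def by blast+
  obtain B where "vertex_cone (convex hull S) v B" and sub: "B \<subseteq> (\<lambda>s. s - v) ` S - {0}"
    using vertex_cone_exists[of S v] S v by metis
  then have cone: "vertex_cone P v B"
    by (subst S(2))
  interpret vertex_cone P v B
    by (rule cone)
  have "int (card B) = aff_dim P"
    using P v unfolding simple_polytope_def card_edges_at_vertex[symmetric] by blast
  then have "card B = dim B"
    by (simp add: aff_dim_eq)
  obtain C where C: "C \<subseteq> B" "independent C" "B \<subseteq> span C" "card C = dim B"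
    by (rule basis_exists[of B])
  then have "C = B"
    using card_subset_eq[OF finite_B] \<open>card B = dim B\<close> by simp
  then have "independent B"
    using C(2) by simp
  moreover have "t - v \<in> B" if t: "closed_segment v t edge_of P" for t
  proof -
    have "v \<in> closed_segment v t" by simp
    then obtain b where b: "b \<in> B" "closed_segment v t = P \<inter> ray v b"
      using edge_is_ray[OF t] by blast
    have "v + b \<in> closed_segment v t"
      using b tips tip_in_ray by blast
    moreover have "v + b extreme_point_of P"
      using sub b(1) by (auto simp: S_def)
    moreover have "v \<in> P" "t \<in> P"
      using edge_of_imp_subset[OF t] by auto
    ultimately have "v + b = v \<or> v + b = t"
      unfolding extreme_point_of_def open_segment_def by blast
    then show ?thesis
      using generator_nonzero b(1) by auto
  qed
  then have "{t - v | t. closed_segment v t edge_of P} \<subseteq> B"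
    by blast
  ultimately show ?thesis
    by (rule independent_mono)
qed

lemma simplex_vertex_independent:
  fixes P :: "'a::euclidean_space set"
  assumes P: "is_simplex P" and v: "v extreme_point_of P"
  shows "independent {t - v | t. t extreme_point_of P \<and> t \<noteq> v}"
proof -
  obtain C where C: "\<not> affine_dependent C" "P = convex hull C"
    using P by (auto simp: is_simplex_def simplex_def)
  have "v \<in> C"
    using C(2) v extreme_point_of_convex_hull by blast
  then have "independent ((\<lambda>x. - v + x) ` (C - {v}))"
    using C affine_dependent_iff_dependent2 by blast
  moreover have "{t - v | t. t extreme_point_of P \<and> t \<noteq> v} \<subseteq> (\<lambda>x. - v + x) ` (C - {v})"
    using C(2) extreme_point_of_convex_hull by auto
  ultimately show ?thesis
    by (rule independent_mono)
qed

lemma simplex_if_edges_to_all_vertices: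
  fixes P :: "'a::euclidean_space set"
  assumes P: "simple_polytope P" and v: "v extreme_point_of P"
    and edges: "\<And>t. t extreme_point_of P \<Longrightarrow> t \<noteq> v \<Longrightarrow> closed_segment v t edge_of P"
  shows "is_simplex P"
proof -
  define S where "S = {x. x extreme_point_of P}"
  have S: "finite S" "P = convex hull S"
    using P polytope_extreme_points unfolding simple_polytope_def S_def by blast+
  have "(\<lambda>x. - v + x) ` (S - {v}) \<subseteq> {t - v | t. closed_segment v t edge_of P}"
    using edges by (auto simp: S_def)
  then have "independent ((\<lambda>x. - v + x) ` (S - {v}))"
    using simple_vertex_edges_independent[OF P v] independent_mono by blast
  then have "\<not> affine_dependent S"
    using affine_dependent_iff_dependent2 v by (metis S_def mem_Collect_eq)
  then show ?thesis
    using S(2) unfolding is_simplex_def simplex_def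
    by (intro exI[of _ "int (card S) - 1"] exI[of _ S]) auto
qed

text \<open>
  Only \<open>p\<close> has to differ from the other three vectors, which makes the lemma usable for
  relations of two or three terms.
\<close>

lemma independent_no_relation:
  assumes A: "independent A" "p \<in> A" "q \<in> A" "r \<in> A" "s \<in> A"
    and ne: "p \<noteq> q" "p \<noteq> r" "p \<noteq> s"
    and eq: "p = \<alpha> *\<^sub>R q + \<beta> *\<^sub>R r + \<gamma> *\<^sub>R s"
  shows False
proof -
  have "q \<in> span (A - {p})" "r \<in> span (A - {p})" "s \<in> span (A - {p})"
    using A ne by (auto intro!: span_base)
  then have "\<alpha> *\<^sub>R q + \<beta> *\<^sub>R r + \<gamma> *\<^sub>R s \<in> span (A - {p})"
    by (intro span_add span_scale)
  then have "p \<in> span (A - {p})"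
    unfolding eq[symmetric] .
  then show False
    using A(1,2) unfolding dependent_def by blast
qed

section \<open>Unimodular vertices\<close>

lemma independent_if_separated:
  fixes B :: "'a::real_inner set"
  assumes "\<And>b. b \<in> B \<Longrightarrow> \<exists>f. f \<bullet> b \<noteq> 0 \<and> (\<forall>b'\<in>B - {b}. f \<bullet> b' = 0)"
  shows "independent B"
  unfolding dependent_def
proof safe
  fix b assume b: "b \<in> B" "b \<in> span (B - {b})"
  obtain f where f: "f \<bullet> b \<noteq> 0" "\<And>b'. b' \<in> B - {b} \<Longrightarrow> f \<bullet> b' = 0"
    using assms[OF b(1)] by blast
  have "f \<bullet> b = 0"
    using b(2) by (induction rule: span_induct) (auto simp: f(2) subspace_def inner_add_right)
  then show False
    using f(1) by simp
qed

lemma independent_not_in_pos_span: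
  assumes "independent B" "b \<in> B"
  shows "b \<notin> pos_span (B - {b})"
  using assms pos_span_subset_span[of "B - {b}"] unfolding dependent_def by blast

lemma independent_imp_int_independent:
  fixes B :: "(real ^ 'n) set"
  assumes "independent B" "finite B"
  shows "int_vec.independent B"
proof
  assume "int_vec.dependent B"
  then obtain u b where u: "b \<in> B" "u b \<noteq> 0" "(\<Sum>x\<in>B. int_scale (u x) x) = 0"
    using int_vec.dependent_finite[OF assms(2)] by blast
  have "(\<Sum>x\<in>B. of_int (u x) *\<^sub>R x) = 0"
    using u(3) by (simp add: int_scale_def)
  then have "of_int (u b) = (0::real)"
    using independentD[OF assms(1) assms(2) subset_refl _ u(1), of "\<lambda>x. of_int (u x)"] by simp
  then show False
    using u(2) by simp
qed

lemma int_multiple_if_in_int_span: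
  fixes B :: "(real ^ 'n) set"
  assumes B: "independent B" "finite B" and b: "b \<in> B" and t: "t *\<^sub>R b \<in> int_vec.span B"
  shows "t \<in> \<int>"
proof -
  obtain u where u: "t *\<^sub>R b = (\<Sum>x\<in>B. int_scale (u x) x)"
    using t int_vec.span_finite[OF B(2)] by auto
  have "(\<Sum>x\<in>B. (of_int (u x) - (if x = b then t else 0)) *\<^sub>R x)
    = (\<Sum>x\<in>B. int_scale (u x) x) - (\<Sum>x\<in>B. if x = b then t *\<^sub>R b else 0)"
    unfolding sum_subtractf[symmetric]
    by (rule sum.cong) (auto simp: int_scale_def algebra_simps)
  also have "\<dots> = 0"
    using B(2) b u by simp
  finally have "of_int (u b) - (if b = b then t else 0) = 0"
    by (rule independentD[OF B(1) B(2) subset_refl _ b])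
  then show ?thesis
    by (metis Ints_of_int eq_iff_diff_eq_0)
qed

text \<open>
  Integrality enters twice. Sums of elements of \<open>B\<close> are at once nonnegative combinations, so
  that \<open>B\<close> generates the cone at \<open>v\<close>, and integral ones, so that \<open>B\<close> generates the lattice. And
  by independence a multiple \<open>t b\<close> in the lattice has integral \<open>t\<close>, so that \<open>b\<close> is the shortest
  lattice vector along its ray.
\<close>

lemma unimodular_vertex:
  fixes S :: "(real ^ 'n) set"
  assumes S: "finite S" "convex hull S \<inter> integral_points = S"
    and v: "v extreme_point_of convex hull S"
    and B: "independent B" "\<And>b. b \<in> B \<Longrightarrow> v + b \<in> S"
    and sums: "\<And>s. s \<in> S \<Longrightarrow> \<exists>bs. set bs \<subseteq> B \<and> s - v = sum_list bs"
  shows "int (card {F. F edge_of convex hull S \<and> v \<in> F}) = aff_dim (convex hull S)"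
    and "lattice_basis
      {u. \<exists>F. F edge_of convex hull S \<and> v \<in> F \<and>
        primitive_direction (polytope_lattice (convex hull S)) F v u}
      (polytope_lattice (convex hull S))"
proof -
  let ?P = "convex hull S" and ?L = "polytope_lattice (convex hull S)"
  have fin: "finite B"
    using B(1) by (rule independent_imp_finite)
  have vS: "v \<in> S"
    using v by (rule extreme_point_of_convex_hull)
  have pos: "sum_list bs \<in> pos_span B" if "set bs \<subseteq> B" for bs
    using that by (induction bs) (auto simp: pos_span_zero fin pos_span_base intro: pos_span_add)
  have int: "sum_list bs \<in> int_vec.span B" if "set bs \<subseteq> B" for bs
    using that by (induction bs)
      (auto simp: int_vec.span_zero int_vec.span_base intro: int_vec.span_add)
  have coverS: "s - v \<in> pos_span B" if "s \<in> S" for s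
    using sums[OF that] pos by auto
  have spanS: "s - v \<in> int_vec.span B" if "s \<in> S" for s
    using sums[OF that] int by auto
  interpret vertex_cone ?P v B
  proof
    show "polytope ?P"
      using S(1) by (rule polytope_convex_hull)
    show "v + b \<in> ?P" if "b \<in> B" for b
      using B(2)[OF that] by (rule hull_inc)
    show "x - v \<in> pos_span B" if "x \<in> ?P" for x
      using coverS that by (rule convex_hull_minus_in_pos_span)
    show "b \<notin> pos_span (B - {b})" if "b \<in> B" for b
      using B(1) that by (rule independent_not_in_pos_span)
  qed (use v fin in auto)
  show "int (card {F. F edge_of ?P \<and> v \<in> F}) = aff_dim ?P"
    by (simp add: card_edges_at_vertex aff_dim_eq dim_eq_card_independent[OF B(1)])
  have L: "?L = int_vec.span B"
  proof (rule subset_antisym)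
    have "x - y \<in> int_vec.span B" if "x \<in> S" "y \<in> S" for x y
      using int_vec.span_diff[OF spanS[OF that(1)] spanS[OF that(2)]] by simp
    then show "?L \<subseteq> int_vec.span B"
      unfolding polytope_lattice_def S(2)
      by (intro int_vec.span_minimal int_vec.subspace_span) auto
    have "b \<in> {x - y | x y. x \<in> S \<and> y \<in> S}" if "b \<in> B" for b
      using B(2)[OF that] vS by (metis (mono_tags, lifting) add_diff_cancel_left' mem_Collect_eq)
    then show "int_vec.span B \<subseteq> ?L"
      unfolding polytope_lattice_def S(2) by (intro int_vec.span_mono) auto
  qed
  have along: "along_edge (?P \<inter> ray v b) v u \<longleftrightarrow> (\<exists>t>0. u = t *\<^sub>R b)" if b: "b \<in> B" for b u
  proof
    assume "along_edge (?P \<inter> ray v b) v u"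
    then obtain t where t: "u \<noteq> 0" "t > 0" "v + t *\<^sub>R u \<in> ray v b"
      by (auto simp: along_edge_def)
    then obtain r where r: "0 \<le> r" "t *\<^sub>R u = r *\<^sub>R b"
      by (auto simp: ray_def)
    then have "u = (r / t) *\<^sub>R b"
      using t(2) by (metis divide_inverse_commute less_irrefl scaleR_left_imp_eq
          divide_inverse left_inverse mult.commute scaleR_one scaleR_scaleR)
    moreover have "r / t > 0"
      using calculation t r by (metis divide_nonneg_pos less_eq_real_def scaleR_zero_left)
    ultimately show "\<exists>t>0. u = t *\<^sub>R b" by blast
  next
    assume "\<exists>t>0. u = t *\<^sub>R b"
    then obtain t where t: "t > 0" "u = t *\<^sub>R b" by blast
    have "v + (1 / t) *\<^sub>R u \<in> ?P \<inter> ray v b"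
      using t tips[OF b] tip_in_ray[of v b] by simp
    then show "along_edge (?P \<inter> ray v b) v u"
      using t generator_nonzero[OF b] unfolding along_edge_def
      by (intro conjI exI[of _ "1 / t"]) auto
  qed
  have primitive: "primitive_direction ?L (?P \<inter> ray v b) v u \<longleftrightarrow> u = b" if b: "b \<in> B" for b u
  proof
    have bL: "b \<in> ?L"
      unfolding L using b by (rule int_vec.span_base)
    have long: "1 \<le> t" if "t > 0" "t *\<^sub>R b \<in> ?L" for t
    proof -
      have "t \<in> \<int>"
        using that(2) unfolding L by (rule int_multiple_if_in_int_span[OF B(1) fin b])
      then show ?thesis
        using that(1) by (auto elim!: Ints_cases)
    qed
    have along_b: "along_edge (?P \<inter> ray v b) v b"
      unfolding along[OF b] by (rule exI[of _ 1]) simp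
    {
      assume prim: "primitive_direction ?L (?P \<inter> ray v b) v u"
      then obtain t where t: "t > 0" "u = t *\<^sub>R b"
        unfolding primitive_direction_def along[OF b] by blast
      have "norm u \<le> norm b"
        using prim bL along_b unfolding primitive_direction_def by blast
      then have "t \<le> 1"
        using t generator_nonzero[OF b] by simp
      moreover have "1 \<le> t"
        using prim t long unfolding primitive_direction_def by blast
      ultimately show "u = b"
        using t(2) by simp
    }
    {
      assume "u = b"
      have "norm b \<le> norm w" if w: "w \<in> ?L" "along_edge (?P \<inter> ray v b) v w" for w
      proof -
        obtain t where t: "t > 0" "w = t *\<^sub>R b"
          using w(2) unfolding along[OF b] by blast
        have "1 * norm b \<le> t * norm b"
          using long t w(1) by (intro mult_right_mono) auto
        then show ?thesis
          using t by simp
      qed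
      then show "primitive_direction ?L (?P \<inter> ray v b) v u"
        unfolding primitive_direction_def \<open>u = b\<close> using bL along_b by blast
    }
  qed
  have "{u. \<exists>F. F edge_of ?P \<and> v \<in> F \<and> primitive_direction ?L F v u}
      = (\<Union>F\<in>{F. F edge_of ?P \<and> v \<in> F}. {u. primitive_direction ?L F v u})"
    by auto
  also have "\<dots> = (\<Union>b\<in>B. {u. primitive_direction ?L (?P \<inter> ray v b) v u})"
    unfolding edges_at_vertex by simp
  also have "\<dots> = (\<Union>b\<in>B. {b})"
    using primitive by (intro SUP_cong) auto
  also have "\<dots> = B"
    by simp
  finally have "{u. \<exists>F. F edge_of ?P \<and> v \<in> F \<and> primitive_direction ?L F v u} = B" .
  then show "lattice_basis {u. \<exists>F. F edge_of ?P \<and> v \<in> F \<and> primitive_direction ?L F v u} ?L"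
    unfolding lattice_basis_def L using independent_imp_int_independent[OF B(1) fin] by simp
qed

section \<open>Edge polytopes of graphs with loops\<close>

definition edge_point :: "'n \<Rightarrow> 'n \<Rightarrow> real ^ 'n::finite" where
  "edge_point i j = axis i 1 + axis j 1"

lemma edge_point_commute: "edge_point i j = edge_point j i"
  by (simp add: edge_point_def add.commute)

lemma edge_point_eq_iff:
  fixes a b c d :: "'n::finite"
  shows "edge_point a b = edge_point c d \<longleftrightarrow> (a = c \<and> b = d) \<or> (a = d \<and> b = c)"
proof
  assume "edge_point a b = edge_point c d"
  then have "(axis a 1 + axis b 1 :: real ^ 'n) $ k = (axis c 1 + axis d 1) $ k" for k
    by (simp add: edge_point_def)
  from this[of a] this[of b] this[of c] this[of d]
  show "(a = c \<and> b = d) \<or> (a = d \<and> b = c)"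
    by (auto simp: axis_def split: if_splits)
qed (auto simp: edge_point_def)

lemma inner_edge_point:
  fixes w :: "'n::finite \<Rightarrow> real"
  shows "(\<chi> k. w k) \<bullet> edge_point i j = w i + w j"
  by (simp add: edge_point_def inner_add_right inner_axis)

text \<open>
  The graph is given by its adjacency relation, a loop at \<open>i\<close> being \<open>adj i i\<close>. As a singleton,
  \<open>{i, i}\<close> would not keep its two-element form under simplification.
\<close>

locale looped_graph =
  fixes adj :: "'n::finite \<Rightarrow> 'n \<Rightarrow> bool"
  assumes adj_sym: "adj i j \<Longrightarrow> adj j i"
    and no_isolated: "\<exists>j. adj i j"
    and loops_adj: "adj i i \<Longrightarrow> adj j j \<Longrightarrow> adj i j"
begin

definition edge_points :: "(real ^ 'n) set" where
  "edge_points = {edge_point i j | i j. adj i j}"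

abbreviation P :: "(real ^ 'n) set" where
  "P \<equiv> convex hull edge_points"

text \<open>
  The point of an edge between two distinct looped vertices is the midpoint of the points of the
  loops. The remaining edges and loops are exactly those whose points are vertices of the
  polytope (\<open>extreme_point_iff_vertex_point\<close>).
\<close>

definition extremal :: "'n \<Rightarrow> 'n \<Rightarrow> bool" where
  "extremal i j \<longleftrightarrow> adj i j \<and> (i = j \<or> \<not> adj i i \<or> \<not> adj j j)"

definition vertex_points :: "(real ^ 'n) set" where
  "vertex_points = {edge_point i j | i j. extremal i j}"

lemma adj_commute: "adj i j \<longleftrightarrow> adj j i"
  using adj_sym by blast

lemma extremal_commute: "extremal i j \<longleftrightarrow> extremal j i"
  unfolding extremal_def using adj_sym by blast

lemma finite_edge_points: "finite edge_points"
proof -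
  have "edge_points \<subseteq> (\<lambda>(i, j). edge_point i j) ` UNIV"
    by (auto simp: edge_points_def)
  then show ?thesis
    by (rule finite_subset) simp
qed

lemma vertex_points_subset: "vertex_points \<subseteq> edge_points"
  by (auto simp: edge_points_def vertex_points_def extremal_def)

lemma finite_vertex_points: "finite vertex_points"
  using vertex_points_subset finite_edge_points by (rule finite_subset)

lemma convex_hull_vertex_points: "convex hull vertex_points = P"
proof (rule subset_antisym)
  show "convex hull vertex_points \<subseteq> P"
    using vertex_points_subset by (rule hull_mono)
  have "edge_point i j \<in> convex hull vertex_points" if "adj i j" for i j
  proof (cases "extremal i j")
    case True
    then show ?thesis
      by (intro hull_inc) (auto simp: vertex_points_def)
  next
    case False
    then have "adj i i" "adj j j"
      using that by (auto simp: extremal_def)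
    then have "edge_point i i \<in> convex hull vertex_points" "edge_point j j \<in> convex hull vertex_points"
      by (auto simp: vertex_points_def extremal_def intro!: hull_inc)
    then have "(1/2) *\<^sub>R edge_point i i + (1/2) *\<^sub>R edge_point j j \<in> convex hull vertex_points"
      by (intro convexD convex_convex_hull) auto
    moreover have "(1/2) *\<^sub>R edge_point i i + (1/2) *\<^sub>R edge_point j j = (edge_point i j :: real ^ 'n)"
      by (simp add: edge_point_def flip: scaleR_2)
    ultimately show ?thesis by simp
  qed
  then show "P \<subseteq> convex hull vertex_points"
    by (intro hull_minimal convex_convex_hull) (auto simp: edge_points_def)
qed

text \<open>
  Weights \<open>w\<close> on the graph vertices define the linear functional with value \<open>w i + w j\<close> at the
  point of \<open>{i, j}\<close>. Where it attains the minimum zero, it cuts out a face.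
\<close>

lemma weight_face:
  fixes w :: "'n \<Rightarrow> real"
  assumes "\<And>i j. extremal i j \<Longrightarrow> 0 \<le> w i + w j"
  shows "convex hull {edge_point i j | i j. extremal i j \<and> w i + w j = 0} face_of P"
proof -
  let ?h = "\<chi> k. w k" and ?Z = "{edge_point i j | i j. extremal i j \<and> w i + w j = 0}"
  have "vertex_points \<subseteq> {x. ?h \<bullet> x \<ge> 0}"
    using assms by (auto simp: vertex_points_def inner_edge_point)
  then have "convex hull vertex_points \<subseteq> {x. ?h \<bullet> x \<ge> 0}"
    by (rule hull_minimal) (rule convex_halfspace_ge)
  then have face: "convex hull vertex_points \<inter> {x. ?h \<bullet> x = 0} face_of convex hull vertex_points"
    by (intro face_of_Int_supporting_hyperplane_ge convex_convex_hull) auto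
  obtain Z where Z: "Z \<subseteq> vertex_points" "convex hull vertex_points \<inter> {x. ?h \<bullet> x = 0} = convex hull Z"
    using face_of_convex_hull_subset[OF finite_imp_compact[OF finite_vertex_points] face] by blast
  have "Z \<subseteq> ?Z"
  proof
    fix z assume z: "z \<in> Z"
    then have "?h \<bullet> z = 0"
      using Z(2) hull_inc[OF z, of convex] by blast
    then show "z \<in> ?Z"
      using z Z(1) by (force simp: vertex_points_def inner_edge_point)
  qed
  moreover have "?Z \<subseteq> convex hull Z"
    unfolding Z(2)[symmetric] by (auto simp: vertex_points_def inner_edge_point intro: hull_inc)
  ultimately have "convex hull ?Z = convex hull Z"
    by (metis (no_types, lifting) convex_convex_hull hull_minimal hull_mono subset_antisym)
  then show ?thesis
    using face Z(2) convex_hull_vertex_points by simp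
qed

lemma extreme_if_weights:
  fixes w :: "'n \<Rightarrow> real"
  assumes "extremal a b" "w a + w b = 0"
    and pos: "\<And>i j. extremal i j \<Longrightarrow> w i + w j > 0 \<or> {i, j} = {a, b}"
  shows "edge_point a b extreme_point_of P"
proof -
  have *: "extremal i j \<and> w i + w j = 0 \<longleftrightarrow> edge_point i j = edge_point a b" for i j
    using assms(1,2) pos[of i j] extremal_commute[of i j]
    by (auto simp: edge_point_eq_iff doubleton_eq_iff add.commute)
  have "{edge_point i j | i j. extremal i j \<and> w i + w j = 0} = {edge_point a b}"
    unfolding * by auto
  moreover have "0 \<le> w i + w j" if "extremal i j" for i j
    using assms(2) pos[OF that] by (auto simp: doubleton_eq_iff)
  ultimately show ?thesis
    using weight_face[of w] by (simp add: face_of_singleton)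
qed

text \<open>
  A loop \<open>a\<close> is isolated by the weight \<open>0\<close> at \<open>a\<close> and \<open>1\<close> elsewhere. For an edge \<open>{a, b}\<close>
  without a loop at \<open>a\<close> the weight \<open>-1\<close> at \<open>a\<close> is harmless: it is compensated at every neighbour
  of \<open>a\<close>, and exactly balanced only at \<open>b\<close>.
\<close>

lemma extreme_point_iff_vertex_point: "x extreme_point_of P \<longleftrightarrow> x \<in> vertex_points"
proof
  assume "x extreme_point_of P"
  then show "x \<in> vertex_points"
    using extreme_point_of_convex_hull convex_hull_vertex_points by metis
next
  assume "x \<in> vertex_points"
  then obtain a b where ab: "x = edge_point a b" "extremal a b"
    by (auto simp: vertex_points_def)
  consider "a = b" | "a \<noteq> b" "\<not> adj a a" | "a \<noteq> b" "\<not> adj b b"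
    using ab(2) by (auto simp: extremal_def)
  then have "edge_point a b extreme_point_of P"
  proof cases
    case 1
    with ab show ?thesis
      by (intro extreme_if_weights[where w = "\<lambda>k. if k = a then 0 else 1"]) auto
  next
    case 2
    with ab show ?thesis
      by (intro extreme_if_weights[where w = "\<lambda>k. if k = a then -1 else if k = b then 1 else 2"])
        (auto simp: extremal_def split: if_splits)
  next
    case 3
    with ab show ?thesis
      by (intro extreme_if_weights[where w = "\<lambda>k. if k = b then -1 else if k = a then 1 else 2"])
        (auto simp: extremal_def split: if_splits)
  qed
  then show "x extreme_point_of P"
    using ab(1) by simp
qed

section \<open>Pairs of generators joined by an edge of the polytope\<close>

definition joined :: "'n \<Rightarrow> 'n \<Rightarrow> 'n \<Rightarrow> 'n \<Rightarrow> bool" where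
  "joined a b c d \<longleftrightarrow> closed_segment (edge_point a b) (edge_point c d) edge_of P"

lemma joined_commute:
  "joined a b c d \<longleftrightarrow> joined c d a b" "joined a b c d \<longleftrightarrow> joined b a c d"
  by (simp_all add: joined_def closed_segment_commute edge_point_commute[of a b])

lemma joined_if_weights:
  fixes w :: "'n \<Rightarrow> real"
  assumes "extremal a b" "extremal c d" "{a, b} \<noteq> {c, d}" "w a + w b = 0" "w c + w d = 0"
    and pos: "\<And>i j. extremal i j \<Longrightarrow> w i + w j > 0 \<or> {i, j} = {a, b} \<or> {i, j} = {c, d}"
  shows "joined a b c d"
proof -
  have *: "extremal i j \<and> w i + w j = 0 \<longleftrightarrow>
      edge_point i j = edge_point a b \<or> edge_point i j = edge_point c d" for i j
    using assms(1,2,4,5) pos[of i j] extremal_commute[of i j]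
    by (auto simp: edge_point_eq_iff doubleton_eq_iff add.commute)
  have "{edge_point i j | i j. extremal i j \<and> w i + w j = 0} = {edge_point a b, edge_point c d}"
    unfolding * by auto
  moreover have "0 \<le> w i + w j" if "extremal i j" for i j
    using assms(4,5) pos[OF that] by (auto simp: doubleton_eq_iff)
  ultimately have "closed_segment (edge_point a b) (edge_point c d) face_of P"
    using weight_face[of w] by (simp add: segment_convex_hull)
  moreover have "edge_point a b \<noteq> edge_point c d"
    using assms(3) by (auto simp: edge_point_eq_iff)
  ultimately show ?thesis
    by (simp add: joined_def edge_of_def segment_convex_hull aff_dim_convex_hull aff_dim_2)
qed

text \<open>
  In all weightings from here on, a vertex of negative weight carries no loop and its neighbours
  have at least the opposite weight. So the functional vanishes only on exactly balanced edges
  and on edges between vertices of weight zero, and the two chosen ones are the only such edges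
  whose points are vertices of the polytope.
\<close>

lemma joined_at_nonloop:
  assumes "\<not> adj a a" "adj a b" "adj a x" "b \<noteq> x"
  shows "joined a b a x"
  using assms
  by (intro joined_if_weights
      [where w = "\<lambda>k. if k = a then -1 else if k = b \<or> k = x then 1 else 2"])
    (auto simp: extremal_def doubleton_eq_iff split: if_splits)

lemma joined_at_common_vertex:
  assumes "\<not> adj b b" "\<not> adj x x" "\<not> adj b x" "adj l b" "adj l x" "b \<noteq> x"
  shows "joined l b l x"
  using assms adj_commute
  by (intro joined_if_weights
      [where w = "\<lambda>k. if k = l then 1 else if k = b \<or> k = x then -1 else 2"])
    (auto simp: extremal_def doubleton_eq_iff split: if_splits)

lemma joined_loop_incident:
  assumes "adj l l" "adj l b" "\<not> adj b b"
  shows "joined l l l b"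
  using assms
  by (intro joined_if_weights[where w = "\<lambda>k. if k = l \<or> k = b then 0 else 1"])
    (auto simp: extremal_def doubleton_eq_iff adj_commute split: if_splits)

lemma joined_loops:
  assumes "adj l l" "adj m m" "l \<noteq> m"
  shows "joined l l m m"
  using assms
  by (intro joined_if_weights[where w = "\<lambda>k. if k = l \<or> k = m then 0 else 1"])
    (auto simp: extremal_def doubleton_eq_iff split: if_splits)

lemma joined_disjoint:
  assumes "\<not> adj c c" "\<not> adj c a" "\<not> adj c b" "\<not> adj a a" "adj a b" "adj c d"
  shows "joined a b c d"
proof -
  have ne: "a \<noteq> b" "c \<noteq> d" "a \<noteq> c" "a \<noteq> d" "b \<noteq> c" "b \<noteq> d"
    using assms adj_commute by auto
  then show ?thesis
    using assms adj_commute
    by (intro joined_if_weights[where w = "\<lambda>k. if k = a then -1 else if k = b then 1 else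
        if k = c then -2 else if k = d then 2 else 3"])
    (auto simp: extremal_def doubleton_eq_iff split: if_splits)
qed

lemma joined_loop_disjoint:
  assumes "adj l l" "\<not> adj b b" "\<not> adj l b" "adj a b"
  shows "joined l l a b"
proof -
  have ne: "a \<noteq> b" "l \<noteq> a" "l \<noteq> b"
    using assms adj_commute by auto
  then show ?thesis
    using assms adj_commute
    by (intro joined_if_weights[where w = "\<lambda>k. if k = l then 0 else if k = a then 1 else
        if k = b then -1 else 2"])
    (auto simp: extremal_def doubleton_eq_iff split: if_splits)
qed

end

section \<open>Integral points of the edge polytope\<close>

lemma nonneg_integral_unit_step:
  fixes x :: "real ^ 'n::finite"
  assumes x: "x \<in> integral_points" "\<And>k. 0 \<le> x $ k" "(\<Sum>k\<in>UNIV. x $ k) = c" and c: "0 < c"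
  obtains i where "x - axis i 1 \<in> integral_points" "\<And>k. 0 \<le> (x - axis i 1) $ k"
    "(\<Sum>k\<in>UNIV. (x - axis i 1) $ k) = c - 1"
proof -
  have "\<exists>i. x $ i \<noteq> 0"
  proof (rule ccontr)
    assume "\<nexists>i. x $ i \<noteq> 0"
    then have "(\<Sum>k\<in>UNIV. x $ k) = 0" by simp
    with x(3) c show False by simp
  qed
  then obtain i where i: "x $ i \<noteq> 0" by blast
  obtain m where m: "x $ i = of_int m"
    using x(1) unfolding integral_points_def by (auto elim!: Ints_cases)
  have one: "1 \<le> x $ i"
    using x(2)[of i] i unfolding m by simp
  show ?thesis
  proof (rule that[of i])
    show "x - axis i 1 \<in> integral_points"
      using x(1) by (auto simp: integral_points_def axis_def)
    show "0 \<le> (x - axis i 1) $ k" for k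
      using x(2)[of k] one by (auto simp: axis_def)
    show "(\<Sum>k\<in>UNIV. (x - axis i 1) $ k) = c - 1"
      using x(3) by (simp add: sum_subtractf axis_def)
  qed
qed

context looped_graph
begin

lemma weights_positive_on_P:
  fixes w :: "'n \<Rightarrow> real"
  assumes "\<And>a b. adj a b \<Longrightarrow> 0 < w a + w b" "edge_point i j \<in> P"
  shows "0 < w i + w j"
proof -
  have "edge_points \<subseteq> {x. (\<chi> k. w k) \<bullet> x > 0}"
    using assms(1) by (auto simp: edge_points_def inner_edge_point)
  then have "P \<subseteq> {x. (\<chi> k. w k) \<bullet> x > 0}"
    by (rule hull_minimal) (rule convex_halfspace_gt)
  then show ?thesis
    using assms(2) by (auto simp: inner_edge_point)
qed

text \<open>
  This is where the condition on pairs of loops matters: if \<open>i\<close> and \<open>j\<close> are distinct and not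
  adjacent, one of them has no loop, and a weighting vanishing on \<open>{i, j}\<close> is positive on all
  edges.
\<close>

lemma edge_point_in_P_imp_adj:
  assumes "edge_point i j \<in> P"
  shows "adj i j"
proof (rule ccontr)
  assume nadj: "\<not> adj i j"
  have "\<exists>w :: 'n \<Rightarrow> real. (\<forall>a b. adj a b \<longrightarrow> 0 < w a + w b) \<and> w i + w j = 0"
  proof -
    consider "i = j" | "i \<noteq> j" "\<not> adj i i" | "i \<noteq> j" "\<not> adj j j"
      using nadj loops_adj by blast
    then show ?thesis
    proof cases
      case 1
      then show ?thesis
        using nadj by (intro exI[of _ "\<lambda>k. if k = i then 0 else 1"]) auto
    next
      case 2
      then show ?thesis
        using nadj adj_commute
        by (intro exI[of _ "\<lambda>k. if k = i then -1 else if k = j then 1 else 2"]) auto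
    next
      case 3
      then show ?thesis
        using nadj adj_commute
        by (intro exI[of _ "\<lambda>k. if k = j then -1 else if k = i then 1 else 2"]) auto
    qed
  qed
  then obtain w :: "'n \<Rightarrow> real" where w: "\<And>a b. adj a b \<Longrightarrow> 0 < w a + w b" "w i + w j = 0"
    by blast
  show False
    using weights_positive_on_P[of w, OF w(1) assms] w(2) by simp
qed

lemma integral_points_of_P: "P \<inter> integral_points = edge_points"
proof (rule subset_antisym)
  show "edge_points \<subseteq> P \<inter> integral_points"
    by (auto simp: edge_points_def integral_points_def edge_point_def axis_def intro!: hull_inc) 
  show "P \<inter> integral_points \<subseteq> edge_points"
  proof safe
    fix x assume x: "x \<in> P" "x \<in> integral_points"
    have "edge_points \<subseteq> {x. (\<chi> k. 1) \<bullet> x = 2}"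
      by (auto simp: edge_points_def inner_edge_point)
    then have "P \<subseteq> {x. (\<chi> k. 1) \<bullet> x = 2}"
      by (rule hull_minimal) (rule convex_hyperplane)
    then have sum: "(\<Sum>k\<in>UNIV. x $ k) = 2"
      using x(1) by (auto simp: inner_vec_def)
    have nonneg: "0 \<le> x $ k" for k
    proof -
      have "edge_points \<subseteq> {x. axis k 1 \<bullet> x \<ge> 0}"
        by (auto simp: edge_points_def edge_point_def inner_add_right inner_axis_axis)
      then have "P \<subseteq> {x. axis k 1 \<bullet> x \<ge> 0}"
        by (rule hull_minimal) (rule convex_halfspace_ge)
      then show ?thesis
        using x(1) by (auto simp: inner_axis')
    qed
    obtain i where i: "x - axis i 1 \<in> integral_points" "\<And>k. 0 \<le> (x - axis i 1) $ k"
      "(\<Sum>k\<in>UNIV. (x - axis i 1) $ k) = 2 - 1"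
      using nonneg_integral_unit_step[OF x(2) nonneg sum] by auto
    obtain j where j: "x - axis i 1 - axis j 1 \<in> integral_points"
      "\<And>k. 0 \<le> (x - axis i 1 - axis j 1) $ k"
      "(\<Sum>k\<in>UNIV. (x - axis i 1 - axis j 1) $ k) = 2 - 1 - 1"
      using nonneg_integral_unit_step[OF i] by auto
    have "(x - axis i 1 - axis j 1) $ k = 0" for k
      using sum_nonneg_0[of UNIV "\<lambda>k. (x - axis i 1 - axis j 1) $ k" k] j(2,3) by simp
    then have "x - axis i 1 - axis j 1 = 0"
      by (simp only: vec_eq_iff zero_index) simp
    then have "x = edge_point i j"
      by (simp add: edge_point_def algebra_simps)
    then show "x \<in> edge_points"
      using x(1) edge_point_in_P_imp_adj[of i j] by (auto simp: edge_points_def)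
  qed
qed

section \<open>Two families with smooth edge polytopes\<close>

lemma smooth_if_unimodular:
  assumes "\<And>v. v \<in> vertex_points \<Longrightarrow> \<exists>B. independent B \<and> (\<forall>b\<in>B. v + b \<in> edge_points) \<and>
    (\<forall>s\<in>edge_points. \<exists>bs. set bs \<subseteq> B \<and> s - v = sum_list bs)"
  shows "smooth_polytope P"
proof -
  have vertex: "int (card {F. F edge_of P \<and> v \<in> F}) = aff_dim P \<and> v \<in> integral_points \<and>
    lattice_basis {u. \<exists>F. F edge_of P \<and> v \<in> F \<and> primitive_direction (polytope_lattice P) F v u}
      (polytope_lattice P)" if v: "v extreme_point_of P" for v
  proof -
    have vV: "v \<in> vertex_points"
      using v extreme_point_iff_vertex_point by blast
    obtain B where B: "independent B" "\<And>b. b \<in> B \<Longrightarrow> v + b \<in> edge_points"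
      "\<And>s. s \<in> edge_points \<Longrightarrow> \<exists>bs. set bs \<subseteq> B \<and> s - v = sum_list bs"
      using assms[OF vV] by blast
    have "v \<in> integral_points"
      using vV vertex_points_subset integral_points_of_P by blast
    then show ?thesis
      using unimodular_vertex[OF finite_edge_points integral_points_of_P v B] by blast
  qed
  have "polytope P"
    using finite_edge_points by (rule polytope_convex_hull)
  then show ?thesis
    using vertex unfolding smooth_polytope_def simple_polytope_def by blast
qed

text \<open>
  The common form of complete bipartite graphs and of complete bipartite graphs extended by a
  looped vertex that is adjacent to everything: in the second case that vertex is added to both
  sides. The loops are the elements of \<open>X \<inter> Y\<close>. Having two elements on either side amounts to a
  \<open>4\<close>-cycle when \<open>X\<close> and \<open>Y\<close> are disjoint.
\<close>

definition biclique :: "'n set \<Rightarrow> 'n set \<Rightarrow> bool" where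
  "biclique X Y \<longleftrightarrow> X \<union> Y = UNIV \<and> (\<forall>z\<in>X \<inter> Y. \<forall>z'\<in>X \<inter> Y. z = z') \<and>
    (\<exists>x\<in>X. \<exists>x'\<in>X. x \<noteq> x') \<and> (\<exists>y\<in>Y. \<exists>y'\<in>Y. y \<noteq> y') \<and>
    (\<forall>i j. adj i j \<longleftrightarrow> (i \<in> X \<and> j \<in> Y) \<or> (i \<in> Y \<and> j \<in> X))"

lemma bicliqueI:
  assumes "X \<union> Y = UNIV" "\<And>z z'. z \<in> X \<inter> Y \<Longrightarrow> z' \<in> X \<inter> Y \<Longrightarrow> z = z'"
    "x \<in> X" "x' \<in> X" "x \<noteq> x'" "y \<in> Y" "y' \<in> Y" "y \<noteq> y'"
    "\<And>i j. adj i j \<longleftrightarrow> (i \<in> X \<and> j \<in> Y) \<or> (i \<in> Y \<and> j \<in> X)"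
  shows "biclique X Y"
  unfolding biclique_def using assms by (intro conjI) (blast+)

text \<open>
  At least two loops and at least one loopless vertex, with precisely those pairs adjacent that
  contain a loop. The edge polytope is the simplex on the points \<open>2 e\<^sub>i\<close> without the corner \<open>\<Sum>w.
  x\<^sub>w > 1\<close>, where \<open>w\<close> runs through the loopless vertices.
\<close>

definition truncated :: bool where
  "truncated \<longleftrightarrow> (\<exists>l m. adj l l \<and> adj m m \<and> l \<noteq> m) \<and> (\<exists>w. \<not> adj w w) \<and>
    (\<forall>i j. adj i j \<longleftrightarrow> adj i i \<or> adj j j)"

lemma weights_axis_diff: "(\<chi> k. w k) \<bullet> (axis x 1 - axis y 1 :: real ^ 'n) = w x - w y"
  by (simp add: inner_diff_right inner_axis)

text \<open>
  The polytope is the product of the simplices on \<open>X\<close> and \<open>Y\<close>. From the vertex of \<open>{a, b}\<close> one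
  can move \<open>a\<close> within \<open>X\<close> or \<open>b\<close> within \<open>Y\<close>, and any other generator is reached by at most one
  move of each kind. The moves are separated by functionals given by weights: for a move \<open>a \<mapsto> x\<close>
  the coordinate \<open>x\<close> serves if \<open>x\<close> lies in \<open>X\<close> only. If \<open>x\<close> is the common element, the negative
  sum of the coordinates in \<open>X - Y\<close> serves: its weights are zero on \<open>Y\<close> and equal throughout \<open>X
  - Y\<close>, where \<open>a\<close> lies.
\<close>

lemma biclique_smooth:
  assumes XY: "biclique X Y"
  shows "smooth_polytope P"
proof (rule smooth_if_unimodular)
  have adj: "adj i j \<longleftrightarrow> (i \<in> X \<and> j \<in> Y) \<or> (i \<in> Y \<and> j \<in> X)" for i j
    using XY unfolding biclique_def by blast
  have uniq: "z = z'" if "z \<in> X" "z \<in> Y" "z' \<in> X" "z' \<in> Y" for z z'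
    using XY that unfolding biclique_def by blast
  have S_intro: "edge_point x y \<in> edge_points" if "x \<in> X" "y \<in> Y" for x y
    using that adj[of x y] unfolding edge_points_def by blast
  have S_elim: "\<exists>x\<in>X. \<exists>y\<in>Y. s = edge_point x y" if "s \<in> edge_points" for s
    using that adj edge_point_commute unfolding edge_points_def by blast
  fix v assume "v \<in> vertex_points"
  then obtain a b where ab: "a \<in> X" "b \<in> Y" "v = edge_point a b"
    using vertex_points_subset S_elim by blast
  define B :: "(real ^ 'n) set" where
    "B = (\<lambda>x. axis x 1 - axis a 1) ` (X - {a}) \<union> (\<lambda>y. axis y 1 - axis b 1) ` (Y - {b})"
  have "independent B"
  proof (rule independent_if_separated)
    fix d assume "d \<in> B"
    then consider x where "x \<in> X" "x \<noteq> a" "d = axis x 1 - axis a 1"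
      | y where "y \<in> Y" "y \<noteq> b" "d = axis y 1 - axis b 1"
      by (auto simp: B_def)
    then show "\<exists>f. f \<bullet> d \<noteq> 0 \<and> (\<forall>b'\<in>B - {d}. f \<bullet> b' = 0)"
    proof cases
      case 1
      define w :: "'n \<Rightarrow> real" where
        "w k = (if x \<in> Y then (if k \<in> X - Y then -1 else 0) else (if k = x then 1 else 0))" for k
      have "w x \<noteq> w a"
        using 1 ab uniq[of x a] by (auto simp: w_def)
      moreover have "w x' = w a" if "x' \<in> X" "x' \<noteq> x" for x'
        using 1 ab that uniq[of x x'] uniq[of x a] by (auto simp: w_def)
      moreover have "w y = w b" if "y \<in> Y" for y
        using ab that by (auto simp: w_def)
      ultimately show ?thesis
        using 1 by (intro exI[of _ "\<chi> k. w k"])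
          (auto simp: weights_axis_diff B_def axis_eq_axis)
    next
      case 2
      define w :: "'n \<Rightarrow> real" where
        "w k = (if y \<in> X then (if k \<in> Y - X then -1 else 0) else (if k = y then 1 else 0))" for k
      have "w y \<noteq> w b"
        using 2 ab uniq[of y b] by (auto simp: w_def)
      moreover have "w y' = w b" if "y' \<in> Y" "y' \<noteq> y" for y'
        using 2 ab that uniq[of y y'] uniq[of y b] by (auto simp: w_def)
      moreover have "w x = w a" if "x \<in> X" for x
        using ab that by (auto simp: w_def)
      ultimately show ?thesis
        using 2 by (intro exI[of _ "\<chi> k. w k"])
          (auto simp: weights_axis_diff B_def axis_eq_axis)
    qed
  qed
  moreover have "v + d \<in> edge_points" if "d \<in> B" for d
  proof -
    have "v + (axis x 1 - axis a 1) = edge_point x b" "v + (axis y 1 - axis b 1) = edge_point a y" for x y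
      by (simp_all add: ab edge_point_def)
    then show ?thesis
      using that ab S_intro unfolding B_def by fastforce
  qed
  moreover have "\<exists>bs. set bs \<subseteq> B \<and> s - v = sum_list bs" if s: "s \<in> edge_points" for s
  proof -
    obtain x y where xy: "x \<in> X" "y \<in> Y" "s = edge_point x y"
      using S_elim[OF s] by blast
    show ?thesis
      using xy ab
      by (intro exI[of _ "(if x = a then [] else [axis x 1 - axis a 1]) @
          (if y = b then [] else [axis y 1 - axis b 1])"])
        (auto simp: B_def edge_point_def)
  qed
  ultimately show "\<exists>B. independent B \<and> (\<forall>b\<in>B. v + b \<in> edge_points) \<and>
    (\<forall>s\<in>edge_points. \<exists>bs. set bs \<subseteq> B \<and> s - v = sum_list bs)"
    by blast
qed

lemma simplex_vertex_no_relation: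
  assumes P: "is_simplex P" and v: "v \<in> vertex_points"
    and in_V: "p \<in> vertex_points" "q \<in> vertex_points" "r \<in> vertex_points" and ne: "p \<noteq> v" "q \<noteq> v" "r \<noteq> v" "p \<noteq> q" "p \<noteq> r"
    and eq: "p - v = \<alpha> *\<^sub>R (q - v) + \<beta> *\<^sub>R (r - v)"
  shows False
proof -
  have "independent {t - v | t. t extreme_point_of P \<and> t \<noteq> v}"
    using P v extreme_point_iff_vertex_point by (intro simplex_vertex_independent) auto
  then have ind: "independent {t - v | t. t \<in> vertex_points \<and> t \<noteq> v}"
    unfolding extreme_point_iff_vertex_point .
  have "p - v \<in> {t - v | t. t \<in> vertex_points \<and> t \<noteq> v}" "q - v \<in> {t - v | t. t \<in> vertex_points \<and> t \<noteq> v}"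
    "r - v \<in> {t - v | t. t \<in> vertex_points \<and> t \<noteq> v}"
    using in_V ne by blast+
  moreover have "p - v = \<alpha> *\<^sub>R (q - v) + \<beta> *\<^sub>R (r - v) + 0 *\<^sub>R (r - v)"
    using eq by simp
  moreover have "p - v \<noteq> q - v" "p - v \<noteq> r - v"
    using ne by simp_all
  ultimately show False
    using independent_no_relation[OF ind] by blast
qed

text \<open>
  Exchanging the ends of two edges gives the parallelogram \<open>\<rho>(xy) + \<rho>(x'y') = \<rho>(xy') + \<rho>(x'y)\<close>.
\<close>

lemma biclique_not_simplex:
  assumes XY: "biclique X Y"
  shows "\<not> is_simplex P"
proof
  assume simplex: "is_simplex P"
  have adj: "adj i j \<longleftrightarrow> (i \<in> X \<and> j \<in> Y) \<or> (i \<in> Y \<and> j \<in> X)" for i j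
    using XY unfolding biclique_def by blast
  have uniq: "z = z'" if "z \<in> X" "z \<in> Y" "z' \<in> X" "z' \<in> Y" for z z'
    using XY that unfolding biclique_def by blast
  obtain x x' y y' where xy: "x \<in> X" "x' \<in> X" "x \<noteq> x'" "y \<in> Y" "y' \<in> Y" "y \<noteq> y'"
    using XY unfolding biclique_def by blast
  have vert: "edge_point i j \<in> vertex_points" if "i \<in> X" "j \<in> Y" for i j
  proof -
    have "extremal i j"
      using that uniq[of i j] by (auto simp: extremal_def adj)
    then show ?thesis
      by (auto simp: vertex_points_def)
  qed
  have "edge_point x' y' \<noteq> edge_point x y"
    using xy uniq[of x y] by (auto simp: edge_point_eq_iff)
  moreover have "edge_point x' y' - edge_point x y = 1 *\<^sub>R (edge_point x' y - edge_point x y)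
      + 1 *\<^sub>R (edge_point x y' - edge_point x y)"
    by (simp add: edge_point_def)
  ultimately show False
    using xy
    by (intro simplex_vertex_no_relation[OF simplex vert vert vert vert, of x y x' y' x' y x y' 1 1])
      (auto simp: edge_point_eq_iff)
qed

text \<open>
  At a loop \<open>a\<close> one moves one of the two ends to an arbitrary vertex. At \<open>{a, b}\<close> with a loop at
  \<open>a\<close> only, \<open>a\<close> moves among the loops and \<open>b\<close> among the loopless vertices, and in addition \<open>b\<close>
  can be moved to \<open>a\<close>. The last move is detected by the sum of the looped coordinates.
\<close>

lemma truncated_smooth:
  assumes T: truncated
  shows "smooth_polytope P"
proof (rule smooth_if_unimodular)
  have adj: "adj i j \<longleftrightarrow> adj i i \<or> adj j j" for i j
    using T unfolding truncated_def by blast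
  have S_intro: "edge_point i j \<in> edge_points" if "adj i i \<or> adj j j" for i j
    using that adj[of i j] unfolding edge_points_def by blast
  have S_elim: "\<exists>i j. adj i i \<and> s = edge_point i j" if "s \<in> edge_points" for s
    using that adj edge_point_commute unfolding edge_points_def by blast
  fix v assume "v \<in> vertex_points"
  then obtain i j where ij: "v = edge_point i j" "extremal i j"
    by (auto simp: vertex_points_def)
  then consider a where "v = edge_point a a" "adj a a"
    | a b where "v = edge_point a b" "adj a a" "\<not> adj b b"
    using adj edge_point_commute unfolding extremal_def by metis
  then show "\<exists>B. independent B \<and> (\<forall>b\<in>B. v + b \<in> edge_points) \<and>
    (\<forall>s\<in>edge_points. \<exists>bs. set bs \<subseteq> B \<and> s - v = sum_list bs)"
  proof cases
    case 1
    define B :: "(real ^ 'n) set" where "B = (\<lambda>k. axis k 1 - axis a 1) ` (UNIV - {a})"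
    have "independent B"
    proof (rule independent_if_separated)
      fix d assume "d \<in> B"
      then obtain k where k: "k \<noteq> a" "d = axis k 1 - axis a 1"
        by (auto simp: B_def)
      show "\<exists>f. f \<bullet> d \<noteq> 0 \<and> (\<forall>b'\<in>B - {d}. f \<bullet> b' = 0)"
        using k by (intro exI[of _ "\<chi> j. if j = k then 1 else 0"])
          (auto simp: weights_axis_diff B_def axis_eq_axis split: if_splits)
    qed
    moreover have "v + d \<in> edge_points" if "d \<in> B" for d
    proof -
      have "v + (axis k 1 - axis a 1) = edge_point a k" for k
        by (simp add: 1 edge_point_def)
      then show ?thesis
        using that 1 S_intro unfolding B_def by fastforce
    qed
    moreover have "\<exists>bs. set bs \<subseteq> B \<and> s - v = sum_list bs" if s: "s \<in> edge_points" for s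
    proof -
      obtain x y where xy: "s = edge_point x y"
        using S_elim[OF s] by blast
      show ?thesis
        using xy 1
        by (intro exI[of _ "(if x = a then [] else [axis x 1 - axis a 1]) @
            (if y = a then [] else [axis y 1 - axis a 1])"])
          (auto simp: B_def edge_point_def)
    qed
    ultimately show ?thesis by blast
  next
    case 2
    define B :: "(real ^ 'n) set" where
      "B = (\<lambda>k. axis k 1 - axis a 1) ` {k. adj k k \<and> k \<noteq> a} \<union>
        (\<lambda>k. axis k 1 - axis b 1) ` {k. \<not> adj k k \<and> k \<noteq> b} \<union> {axis a 1 - axis b 1}"
    have "independent B"
    proof (rule independent_if_separated)
      fix d assume "d \<in> B"
      then consider k where "adj k k" "k \<noteq> a" "d = axis k 1 - axis a 1"
        | k where "\<not> adj k k" "k \<noteq> b" "d = axis k 1 - axis b 1"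
        | "d = axis a 1 - axis b 1"
        by (auto simp: B_def)
      then show "\<exists>f. f \<bullet> d \<noteq> 0 \<and> (\<forall>b'\<in>B - {d}. f \<bullet> b' = 0)"
      proof cases
        case (1 k)
        then show ?thesis
          using 2 by (intro exI[of _ "\<chi> j. if j = k then 1 else 0"])
            (auto simp: weights_axis_diff B_def axis_eq_axis split: if_splits)
      next
        case (2 k)
        then show ?thesis
          using \<open>adj a a\<close> \<open>\<not> adj b b\<close> by (intro exI[of _ "\<chi> j. if j = k then 1 else 0"])
            (auto simp: weights_axis_diff B_def axis_eq_axis split: if_splits)
      next
        case 3
        then show ?thesis
          using 2 by (intro exI[of _ "\<chi> j. if adj j j then 1 else 0"])
            (auto simp: weights_axis_diff B_def axis_eq_axis split: if_splits)
      qed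
    qed
    moreover have "v + d \<in> edge_points" if "d \<in> B" for d
    proof -
      have "v + (axis k 1 - axis a 1) = edge_point k b" "v + (axis k 1 - axis b 1) = edge_point a k"
        for k
        by (simp_all add: 2 edge_point_def)
      then show ?thesis
        using that 2 S_intro unfolding B_def by fastforce
    qed
    moreover have "\<exists>bs. set bs \<subseteq> B \<and> s - v = sum_list bs" if s: "s \<in> edge_points" for s
    proof -
      obtain x y where xy: "adj x x" "s = edge_point x y"
        using S_elim[OF s] by blast
      show ?thesis
        using xy 2
        by (intro exI[of _ "(if x = a then [] else [axis x 1 - axis a 1]) @
            (if adj y y then (axis a 1 - axis b 1) # (if y = a then [] else [axis y 1 - axis a 1])
             else if y = b then [] else [axis y 1 - axis b 1])"])
          (auto simp: B_def edge_point_def)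
    qed
    ultimately show ?thesis by blast
  qed
qed

text \<open>
  Two loops and a loopless vertex span a trapezoid: \<open>\<rho>(ll) + 2 \<rho>(mw) = \<rho>(mm) + 2 \<rho>(lw)\<close>.
\<close>

lemma truncated_not_simplex:
  assumes T: truncated
  shows "\<not> is_simplex P"
proof
  assume simplex: "is_simplex P"
  obtain l m w where lmw: "adj l l" "adj m m" "l \<noteq> m" "\<not> adj w w"
    using T unfolding truncated_def by blast
  have "adj l w" "adj m w"
    using T lmw unfolding truncated_def by blast+
  then have vert: "edge_point l l \<in> vertex_points" "edge_point m m \<in> vertex_points" "edge_point l w \<in> vertex_points" "edge_point m w \<in> vertex_points"
    using lmw by (auto simp: vertex_points_def extremal_def)
  have "edge_point l l - edge_point m m = 2 *\<^sub>R (edge_point l w - edge_point m m)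
      + (-2) *\<^sub>R (edge_point m w - edge_point m m)"
    by (simp add: edge_point_def algebra_simps scaleR_2)
  then show False
    using lmw
    by (intro simplex_vertex_no_relation[OF simplex vert(2) vert(1) vert(3) vert(4), of 2 "-2"])
      (auto simp: edge_point_eq_iff)
qed

end

section \<open>Forbidden configurations in simple edge polytopes\<close>

locale simple_edge_polytope = looped_graph adj for adj :: "'n::finite \<Rightarrow> 'n \<Rightarrow> bool" +
  assumes simple: "simple_polytope P"
begin

lemma no_relation_between_neighbours:
  assumes v: "extremal a b"
    and joined: "joined a b p1 p2" "joined a b q1 q2" "joined a b r1 r2" "joined a b s1 s2"
    and ne: "edge_point p1 p2 \<noteq> edge_point q1 q2" "edge_point p1 p2 \<noteq> edge_point r1 r2"
      "edge_point p1 p2 \<noteq> edge_point s1 s2"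
    and eq: "edge_point p1 p2 - edge_point a b = \<alpha> *\<^sub>R (edge_point q1 q2 - edge_point a b)
      + \<beta> *\<^sub>R (edge_point r1 r2 - edge_point a b) + \<gamma> *\<^sub>R (edge_point s1 s2 - edge_point a b)"
  shows False
proof -
  let ?v = "edge_point a b"
  let ?A = "{t - ?v | t. closed_segment ?v t edge_of P}"
  have "?v extreme_point_of P"
    using v extreme_point_iff_vertex_point by (auto simp: vertex_points_def)
  then have ind: "independent ?A"
    by (rule simple_vertex_edges_independent[OF simple])
  have A: "edge_point i j - ?v \<in> ?A" if "joined a b i j" for i j
    using that unfolding joined_def by blast
  have "edge_point p1 p2 - ?v \<noteq> edge_point q1 q2 - ?v"
    "edge_point p1 p2 - ?v \<noteq> edge_point r1 r2 - ?v"
    "edge_point p1 p2 - ?v \<noteq> edge_point s1 s2 - ?v"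
    using ne by simp_all
  then show False
    by (rule independent_no_relation[OF ind A[OF joined(1)] A[OF joined(2)] A[OF joined(3)]
          A[OF joined(4)] _ _ _ eq])
qed

text \<open>
  The three inequalities make \<open>\<rho>(ij)\<close> different from the other three points.
\<close>

lemma no_square:
  assumes v: "extremal a b"
    and joined: "joined a b i j" "joined a b k l" "joined a b i l" "joined a b k j"
    and ne: "i \<noteq> k" "j \<noteq> l" "i \<noteq> l"
  shows False
proof (rule no_relation_between_neighbours[OF v joined])
  show "edge_point i j - edge_point a b = (-1) *\<^sub>R (edge_point k l - edge_point a b)
      + 1 *\<^sub>R (edge_point i l - edge_point a b) + 1 *\<^sub>R (edge_point k j - edge_point a b)"
    by (simp add: edge_point_def)
qed (use ne in \<open>auto simp: edge_point_eq_iff\<close>)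

lemma no_trapezoid:
  assumes v: "extremal a b"
    and joined: "joined a b l l" "joined a b m m" "joined a b l w" "joined a b m w"
    and ne: "l \<noteq> m" "w \<noteq> l"
  shows False
proof (rule no_relation_between_neighbours[OF v joined])
  show "edge_point l l - edge_point a b = 1 *\<^sub>R (edge_point m m - edge_point a b)
      + 2 *\<^sub>R (edge_point l w - edge_point a b) + (-2) *\<^sub>R (edge_point m w - edge_point a b)"
    by (simp add: edge_point_def algebra_simps scaleR_2)
qed (use ne in \<open>auto simp: edge_point_eq_iff\<close>)

text \<open>
  The point of the edge \<open>{a, b}\<close> is joined to the points of the four edges leaving it, since
  neither \<open>a\<close> nor \<open>b\<close> has a loop, and these form a square.
\<close>

lemma no_diamond:
  assumes nonloop: "\<not> adj a a" "\<not> adj b b" and ab: "adj a b"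
    and x: "adj a x" "adj b x" and y: "adj a y" "adj b y" and ne: "x \<noteq> y"
  shows False
proof (rule no_square[of a b a x b y])
  show "extremal a b"
    using nonloop ab by (auto simp: extremal_def)
  have d: "a \<noteq> b" "a \<noteq> x" "a \<noteq> y" "b \<noteq> x" "b \<noteq> y"
    using nonloop ab x y adj_sym by blast+
  show "joined a b a x" "joined a b a y"
    using nonloop ab x y d by (auto intro!: joined_at_nonloop)
  have "joined b a b x" "joined b a b y"
    using nonloop ab x y d adj_sym by (auto intro!: joined_at_nonloop)
  then show "joined a b b x" "joined a b b y"
    using joined_commute(2) by blast+
  show "a \<noteq> b" "x \<noteq> y" "a \<noteq> y"
    using d ne by auto
qed

lemma unjoined_vertex_exists:
  assumes "\<not> is_simplex P" "extremal a b"
  obtains c d where "extremal c d" "edge_point c d \<noteq> edge_point a b" "\<not> joined a b c d"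
proof -
  have "edge_point a b extreme_point_of P"
    using assms(2) extreme_point_iff_vertex_point by (auto simp: vertex_points_def)
  then obtain t where "t extreme_point_of P" "t \<noteq> edge_point a b"
    "\<not> closed_segment (edge_point a b) t edge_of P"
    using assms(1) simplex_if_edges_to_all_vertices[OF simple] by blast
  moreover from this obtain c d where "t = edge_point c d" "extremal c d"
    unfolding extreme_point_iff_vertex_point vertex_points_def by blast
  ultimately show ?thesis
    using that unfolding joined_def by blast
qed

section \<open>Graphs without loops\<close>

definition four_cycle :: "'n \<Rightarrow> 'n \<Rightarrow> 'n \<Rightarrow> 'n \<Rightarrow> bool" where
  "four_cycle a b c d \<longleftrightarrow> adj a b \<and> adj b c \<and> adj c d \<and> adj d a \<and> a \<noteq> c \<and> b \<noteq> d"

lemma four_cycle_rotate: "four_cycle a b c d \<Longrightarrow> four_cycle b c d a"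
  unfolding four_cycle_def by blast

text \<open>
  Two generators that are not joined belong to disjoint edges, because \<open>joined_at_nonloop\<close>
  applies at a common end. By \<open>joined_disjoint\<close> no end of either edge can be nonadjacent to both
  ends of the other, and this closes a \<open>4\<close>-cycle.
\<close>

lemma four_cycle_exists:
  assumes no_loops: "\<And>i. \<not> adj i i" and nonsimplex: "\<not> is_simplex P"
  shows "\<exists>a b c d. four_cycle a b c d"
proof -
  obtain a b where ab: "adj a b"
    using no_isolated by blast
  then have "extremal a b"
    using no_loops by (auto simp: extremal_def)
  then obtain c d where cd: "extremal c d" "edge_point c d \<noteq> edge_point a b" "\<not> joined a b c d"
    using unjoined_vertex_exists nonsimplex by blast
  have ba: "adj b a" and cd': "adj c d" "adj d c"
    using ab cd adj_sym by (auto simp: extremal_def)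
  have unjoined: "\<not> joined a b c d" "\<not> joined b a c d" "\<not> joined a b d c" "\<not> joined b a d c"
    "\<not> joined c d a b" "\<not> joined d c a b"
    using cd(3) joined_commute by metis+
  have ne: "a \<noteq> c" "a \<noteq> d" "b \<noteq> c" "b \<noteq> d"
    using unjoined joined_at_nonloop no_loops ab ba cd(2) cd' unfolding edge_point_eq_iff by metis+
  have "adj c a \<or> adj c b" "adj d a \<or> adj d b" "adj a c \<or> adj a d" "adj b c \<or> adj b d"
    using unjoined joined_disjoint[of c a b d] joined_disjoint[of d a b c]
      joined_disjoint[of a c d b] joined_disjoint[of b c d a] no_loops ab ba cd' joined_commute
    by metis+
  then have "four_cycle a b c d \<or> four_cycle a b d c"
    unfolding four_cycle_def using ne ab ba cd' adj_sym by blast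
  then show ?thesis by blast
qed

lemma four_cycle_no_chord:
  assumes "\<And>i. \<not> adj i i" "four_cycle a b c d"
  shows "\<not> adj a c" "\<not> adj b d"
  using assms no_diamond[of a c b d] no_diamond[of b d a c] adj_sym
  unfolding four_cycle_def by blast+

text \<open>
  Otherwise \<open>c\<close> is adjacent to neither end of \<open>{a, e}\<close>, so that the point of \<open>{a, e}\<close> is joined
  to the points of all four edges of the cycle.
\<close>

lemma adj_opposite:
  assumes no_loops: "\<And>i. \<not> adj i i" and cyc: "four_cycle a b c d"
    and e: "e \<notin> {a, b, c, d}" "adj e a"
  shows "adj e c"
proof (rule ccontr)
  assume nec: "\<not> adj e c"
  have abcd: "adj a b" "adj b c" "adj c d" "adj d a" "a \<noteq> c" "b \<noteq> d"
    using cyc unfolding four_cycle_def by auto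
  have nca: "\<not> adj c a" "\<not> adj c e"
    using four_cycle_no_chord[OF no_loops cyc] nec adj_sym by blast+
  have sym: "adj a e" "adj a d" "adj c b"
    using abcd e(2) adj_sym by blast+
  show False
  proof (rule no_square[of a e a b c d])
    show "extremal a e"
      using sym no_loops by (auto simp: extremal_def)
    show "joined a e a b" "joined a e a d"
      using joined_at_nonloop no_loops sym abcd e(1) by auto
    show "joined a e c d" "joined a e c b"
      using joined_disjoint[of c a e] nca no_loops sym abcd by auto
    show "a \<noteq> c" "b \<noteq> d" "a \<noteq> d"
      using abcd no_loops by auto
  qed
qed

text \<open>
  A vertex adjacent to both ends of an edge of the cycle is adjacent to the whole cycle, and a
  diamond arises. If \<open>e\<close> is adjacent to no vertex of the cycle, any edge at \<open>e\<close> is joined to the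
  square of the cycle.
\<close>

lemma adj_exactly_one_side:
  assumes no_loops: "\<And>i. \<not> adj i i" and cyc: "four_cycle a b c d" and e: "e \<notin> {a, b, c, d}"
  shows "adj e a \<longleftrightarrow> \<not> adj e b"
proof -
  have abcd: "adj a b" "adj b c" "adj c d" "adj d a" "a \<noteq> c" "b \<noteq> d"
    using cyc unfolding four_cycle_def by auto
  note rot = four_cycle_rotate[OF cyc] four_cycle_rotate[OF four_cycle_rotate[OF cyc]]
    four_cycle_rotate[OF four_cycle_rotate[OF four_cycle_rotate[OF cyc]]]
  have opp: "adj e a \<longleftrightarrow> adj e c" "adj e b \<longleftrightarrow> adj e d"
    using adj_opposite[OF no_loops cyc] adj_opposite[OF no_loops rot(1)]
      adj_opposite[OF no_loops rot(2)] adj_opposite[OF no_loops rot(3)] e by blast+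
  have "\<not> (adj e a \<and> adj e b)"
    using no_diamond[of e b a c] no_loops abcd opp adj_sym by blast
  moreover have "adj e a \<or> adj e b"
  proof (rule ccontr)
    assume none: "\<not> (adj e a \<or> adj e b)"
    obtain f where f: "adj e f"
      using no_isolated by blast
    have "joined a b e f" "joined c d e f" "joined a d e f" "joined c b e f"
      using joined_disjoint none opp no_loops abcd f adj_sym by metis+
    then have "joined e f a b" "joined e f c d" "joined e f a d" "joined e f c b"
      using joined_commute(1) by blast+
    moreover have "extremal e f"
      using f no_loops by (auto simp: extremal_def)
    moreover have "a \<noteq> d"
      using abcd no_loops by blast
    ultimately show False
      using no_square[of e f a b c d] abcd by blast
  qed
  ultimately show ?thesis by blast
qed

text \<open>
  Each vertex is adjacent to exactly one of the neighbouring vertices \<open>a\<close> and \<open>b\<close> of a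
  \<open>4\<close>-cycle; this is the bipartition. It is complete because any vertex \<open>y\<close> of the class of \<open>b\<close>
  can replace \<open>d\<close> in the cycle.
\<close>

lemma loopless_biclique:
  assumes no_loops: "\<And>i. \<not> adj i i" and nonsimplex: "\<not> is_simplex P"
  shows "\<exists>X Y. biclique X Y"
proof -
  obtain a b c d where cyc: "four_cycle a b c d"
    using four_cycle_exists[OF assms] by blast
  have abcd: "adj a b" "adj b c" "adj c d" "adj d a" "a \<noteq> c" "b \<noteq> d"
    using cyc unfolding four_cycle_def by auto
  have sym: "adj b a" "adj c b" "adj d c" "adj a d"
    using abcd adj_sym by blast+
  note rot = four_cycle_rotate[OF cyc]
  have nchord: "\<not> adj a c" "\<not> adj b d" "\<not> adj c a" "\<not> adj d b"
    using four_cycle_no_chord[OF no_loops cyc] adj_sym by blast+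
  define X Y where "X = {x. adj x b}" and "Y = {y. adj y a}"
  have one: "x \<in> X \<longleftrightarrow> x \<notin> Y" for x
  proof (cases "x \<in> {a, b, c, d}")
    case True
    then show ?thesis
      using abcd sym nchord no_loops by (auto simp: X_def Y_def)
  next
    case False
    then show ?thesis
      using adj_exactly_one_side[OF no_loops cyc False] by (auto simp: X_def Y_def)
  qed
  have Xd: "adj x d" if "x \<in> X" for x
    using that adj_opposite[OF no_loops rot, of x] abcd sym nchord no_loops by (auto simp: X_def)
  have Yc: "adj y c" if "y \<in> Y" for y
    using that adj_opposite[OF no_loops cyc, of y] abcd sym nchord no_loops by (auto simp: Y_def)
  have XX: "\<not> adj x x'" if "x \<in> X" "x' \<in> X" for x x'
    using that no_diamond[of x x' b d] Xd no_loops abcd by (auto simp: X_def)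
  have YY: "\<not> adj y y'" if "y \<in> Y" "y' \<in> Y" for y y'
    using that no_diamond[of y y' a c] Yc no_loops abcd by (auto simp: Y_def)
  have XY: "adj x y" if x: "x \<in> X" and y: "y \<in> Y" for x y
  proof (cases "x \<in> {a, b, c, d} \<or> y \<in> {a, b, c, d}")
    case True
    have "x \<noteq> b" "x \<noteq> d" "y \<noteq> a" "y \<noteq> c"
      using x y no_loops nchord by (auto simp: X_def Y_def)
    then show ?thesis
      using True x y Xd[OF x] Yc[OF y] adj_sym by (auto simp: X_def Y_def)
  next
    case False
    then have "four_cycle b c y a"
      using abcd y Yc[OF y] adj_sym unfolding four_cycle_def Y_def by blast
    moreover have "x \<noteq> y"
      using x y one by blast
    ultimately show ?thesis
      using False x adj_opposite[OF no_loops, of b c y a x] by (auto simp: X_def)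
  qed
  have "adj i j \<longleftrightarrow> (i \<in> X \<and> j \<in> Y) \<or> (i \<in> Y \<and> j \<in> X)" for i j
    using XX[of i j] YY[of i j] XY[of i j] XY[of j i] one[of i] one[of j] adj_sym by blast
  moreover have "X \<union> Y = UNIV" "X \<inter> Y = {}"
    using one by blast+
  moreover have "a \<in> X" "c \<in> X" "b \<in> Y" "d \<in> Y"
    using abcd sym by (auto simp: X_def Y_def)
  ultimately have "biclique X Y"
    unfolding biclique_def using abcd(5,6) by blast
  then show ?thesis by blast
qed

section \<open>Graphs with loops\<close>

definition loop_triangle :: "'n \<Rightarrow> 'n \<Rightarrow> 'n \<Rightarrow> bool" where
  "loop_triangle l a b \<longleftrightarrow>
     adj l l \<and> \<not> adj a a \<and> \<not> adj b b \<and> adj l a \<and> adj l b \<and> adj a b"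

definition loop_pair :: "'n \<Rightarrow> 'n \<Rightarrow> 'n \<Rightarrow> bool" where
  "loop_pair l m w \<longleftrightarrow>
     adj l l \<and> adj m m \<and> l \<noteq> m \<and> \<not> adj w w \<and> adj l w \<and> adj m w"

lemma loop_triangle_swap: "loop_triangle l a b \<Longrightarrow> loop_triangle l b a"
  unfolding loop_triangle_def using adj_sym by blast

lemma loop_pair_swap: "loop_pair l m w \<Longrightarrow> loop_pair m l w"
  unfolding loop_pair_def by blast

text \<open>
  The loop at \<open>l\<close> is joined to every other loop and to every edge from \<open>l\<close> to a loopless vertex.
  So an unjoined vertex of the polytope is the point of an edge \<open>{j, k}\<close> avoiding \<open>l\<close>, with \<open>k\<close>
  loopless, and every loopless end of it is adjacent to \<open>l\<close>. Whether \<open>j\<close> has a loop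
  distinguishes the two configurations.
\<close>

lemma loop_configuration_exists:
  assumes nonsimplex: "\<not> is_simplex P" and l: "adj l l"
  shows "(\<exists>a b. loop_triangle l a b) \<or> (\<exists>m w. loop_pair l m w)"
proof -
  have "extremal l l"
    using l by (simp add: extremal_def)
  then obtain c d where cd: "extremal c d" "edge_point c d \<noteq> edge_point l l" "\<not> joined l l c d"
    using unjoined_vertex_exists nonsimplex by blast
  \<comment> \<open>order the ends so that \<open>k\<close> is loopless unless the unjoined generator is itself a loop\<close>
  have "\<exists>j k. extremal j k \<and> \<not> joined l l j k \<and> edge_point j k \<noteq> edge_point l l
    \<and> (j = k \<or> \<not> adj k k)"
    using cd extremal_commute joined_commute edge_point_commute unfolding extremal_def by metis
  then obtain j k where jk: "extremal j k" "\<not> joined l l j k" "edge_point j k \<noteq> edge_point l l"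
    "j = k \<or> \<not> adj k k" by blast
  have adj: "adj j k" "adj k j"
    using jk(1) adj_sym by (auto simp: extremal_def)
  have "j \<noteq> k"
    using joined_loops[OF l, of k] jk(2,3) adj by auto
  then have k: "\<not> adj k k"
    using jk(4) by blast
  have "j \<noteq> l"
    using joined_loop_incident[OF l, of k] jk(2) adj k by blast
  have lk: "adj l k"
    using joined_loop_disjoint[OF l k _ adj(1)] jk(2) by blast
  show ?thesis
  proof (cases "adj j j")
    case True
    then have "loop_pair l j k"
      unfolding loop_pair_def using l k lk adj \<open>j \<noteq> l\<close> by blast
    then show ?thesis by blast
  next
    case False
    have "\<not> joined l l k j"
      using jk(2) joined_commute by metis
    then have "adj l j"
      using joined_loop_disjoint[OF l False _ adj(2)] by blast
    then have "loop_triangle l j k"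
      unfolding loop_triangle_def using False l k lk adj by blast
    then show ?thesis by blast
  qed
qed

text \<open>
  Otherwise the point of \<open>{a, c}\<close> is joined to the square \<open>\<rho>(ll) + \<rho>(ab) = \<rho>(lb) + \<rho>(al)\<close>, which
  the next three lemmas use as well.
\<close>

lemma loop_triangle_not_only_first:
  assumes T: "loop_triangle l a b" and c: "\<not> adj c c" "\<not> adj c l" "adj c a"
  shows "adj c b"
proof (rule ccontr)
  assume cb: "\<not> adj c b"
  have T': "adj l l" "\<not> adj a a" "\<not> adj b b" "adj l a" "adj l b" "adj a b"
    "adj a l" "adj b l" "adj b a" "a \<noteq> l" "b \<noteq> l" "c \<noteq> l" "c \<noteq> b"
    using T c adj_sym unfolding loop_triangle_def by blast+
  have c': "\<not> adj l c" "adj a c"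
    using c adj_sym by blast+
  show False
  proof (rule no_square[of a c l l a b])
    show "extremal a c"
      using T' c c' by (auto simp: extremal_def)
    show "joined a c l l"
      using joined_loop_disjoint[of l c a] T' c c' joined_commute(1) by blast
    show "joined a c a b" "joined a c a l"
      using joined_at_nonloop T' c c' by auto
    have "joined b l c a"
      using joined_disjoint[of c b l a] T' c cb by blast
    then show "joined a c l b"
      using joined_commute by metis
  qed (use T' in auto)
qed

text \<open>
  Suppose that \<open>c\<close> is not adjacent to \<open>l\<close>. Then it is adjacent to neither or both of \<open>a\<close> and
  \<open>b\<close>; the latter yields a diamond, and in the former case any edge at \<open>c\<close> is joined to the
  square.
\<close>

lemma loop_triangle_adj_loop:
  assumes T: "loop_triangle l a b" and c: "\<not> adj c c" "c \<noteq> a" "c \<noteq> b"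
  shows "adj c l"
proof (rule ccontr)
  assume cl: "\<not> adj c l"
  have T': "adj l l" "\<not> adj a a" "\<not> adj b b" "adj l a" "adj l b" "adj a b"
    "adj a l" "adj b l" "adj b a" "a \<noteq> l" "b \<noteq> l"
    using T adj_sym unfolding loop_triangle_def by blast+
  have lc: "\<not> adj l c"
    using cl adj_sym by blast
  have "adj c a \<longleftrightarrow> adj c b"
    using loop_triangle_not_only_first[OF T c(1) cl]
      loop_triangle_not_only_first[OF loop_triangle_swap[OF T] c(1) cl] by blast
  moreover have "\<not> (adj c a \<and> adj c b)"
    using no_diamond[of a b l c] T' adj_sym lc by blast
  ultimately have none: "\<not> adj c a" "\<not> adj c b" by blast+
  obtain d where d: "adj c d" "adj d c"
    using no_isolated adj_sym by blast
  show False
  proof (rule no_square[of c d l l a b])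
    show "extremal c d"
      using c d by (auto simp: extremal_def)
    have "joined l l d c"
      using joined_loop_disjoint T' c lc d by blast
    then show "joined c d l l"
      using joined_commute by metis
    have "joined a b c d" "joined a l c d" "joined b l c d"
      using joined_disjoint[OF c(1)] none cl T' d by blast+
    then show "joined c d a b" "joined c d a l" "joined c d l b"
      using joined_commute by metis+
  qed (use T' in auto)
qed

text \<open>
  Adjacency to both \<open>a\<close> and \<open>b\<close> yields a diamond. If \<open>c\<close> is adjacent to neither, the point of
  \<open>{l, c}\<close> is joined to the square.
\<close>

lemma loop_triangle_exactly_one:
  assumes T: "loop_triangle l a b" and c: "\<not> adj c c" "c \<noteq> a" "c \<noteq> b"
  shows "adj c a \<longleftrightarrow> \<not> adj c b"
proof -
  have T': "adj l l" "\<not> adj a a" "\<not> adj b b" "adj l a" "adj l b" "adj a b"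
    "adj a l" "adj b l" "adj b a" "a \<noteq> l" "b \<noteq> l"
    using T adj_sym unfolding loop_triangle_def by blast+
  have cl: "adj c l" "adj l c"
    using loop_triangle_adj_loop[OF T c] adj_sym by blast+
  have "\<not> (adj c a \<and> adj c b)"
    using no_diamond[of a b l c] T' adj_sym c(1) cl by blast
  moreover have "adj c a \<or> adj c b"
  proof (rule ccontr)
    assume none: "\<not> (adj c a \<or> adj c b)"
    show False
    proof (rule no_square[of l c l l a b])
      show "extremal l c"
        using c cl by (auto simp: extremal_def)
      have "joined l l l c"
        using joined_loop_incident T' cl c by blast
      then show "joined l c l l"
        using joined_commute by metis
      show "joined l c l b"
        using joined_at_common_vertex[of c b l] T' c cl none by blast
      have "joined l c l a"
        using joined_at_common_vertex[of c a l] T' c cl none by blast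
      then show "joined l c a l"
        using joined_commute by metis
      have "joined a b c l"
        using joined_disjoint[of c a b l] T' c cl none by blast
      then show "joined l c a b"
        using joined_commute by metis
    qed (use T' in auto)
  qed
  ultimately show ?thesis by blast
qed

text \<open>
  If \<open>m\<close> is adjacent to neither \<open>a\<close> nor \<open>b\<close>, the loop at \<open>m\<close> is joined to the square. If it is
  adjacent to \<open>b\<close> only, the point of \<open>{l, b}\<close> need not be joined to that of the loop at \<open>m\<close>; the
  relation \<open>\<rho>(ll) + 2 \<rho>(ab) + \<rho>(mm) = 2 \<rho>(la) + 2 \<rho>(mb)\<close> replaces the square.
\<close>

lemma loop_triangle_other_loop_adj:
  assumes T: "loop_triangle l a b" and m: "adj m m" "m \<noteq> l"
  shows "adj m a"
proof (rule ccontr)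
  assume ma: "\<not> adj m a"
  have T': "adj l l" "\<not> adj a a" "\<not> adj b b" "adj l a" "adj l b" "adj a b"
    "adj a l" "adj b l" "adj b a" "a \<noteq> l" "b \<noteq> l"
    using T adj_sym unfolding loop_triangle_def by blast+
  have v: "extremal m m"
    using m by (simp add: extremal_def)
  have ll: "joined m m l l"
    using joined_loops m T' by blast
  have la: "joined m m l a" and ba: "joined m m b a"
    using joined_loop_disjoint m T' ma by blast+
  show False
  proof (cases "adj m b")
    case True
    have "joined m m m b"
      using joined_loop_incident m T' True by blast
    then show False
    proof (rule no_relation_between_neighbours[OF v ll la _ ba])
      show "edge_point l l - edge_point m m = 2 *\<^sub>R (edge_point l a - edge_point m m)
          + 2 *\<^sub>R (edge_point m b - edge_point m m) + (-2) *\<^sub>R (edge_point b a - edge_point m m)"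
        by (simp add: edge_point_def algebra_simps scaleR_2)
    qed (use T' m in \<open>auto simp: edge_point_eq_iff\<close>)
  next
    case False
    have lb: "joined m m l b"
      using joined_loop_disjoint m T' False by blast
    show False
    proof (rule no_square[OF v ll _ lb])
      show "joined m m a b" "joined m m a l"
        using la ba joined_commute by metis+
    qed (use T' in auto)
  qed
qed

lemma loop_triangle_unique_loop:
  assumes T: "loop_triangle l a b" and m: "adj m m"
  shows "m = l"
proof (rule ccontr)
  assume "m \<noteq> l"
  then have "adj m a" "adj m b"
    using loop_triangle_other_loop_adj[OF T m] loop_triangle_other_loop_adj[OF loop_triangle_swap[OF T] m]
    by blast+
  then show False
    using no_diamond[of a b l m] T adj_sym \<open>m \<noteq> l\<close> unfolding loop_triangle_def by blast
qed

text \<open>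
  As in the loopless case, adjacency to \<open>a\<close> or \<open>b\<close> splits the loopless vertices into two
  classes, while \<open>l\<close> belongs to both. Replacing \<open>a\<close> or \<open>b\<close> by another member of its class again
  gives a triangle at \<open>l\<close>, which determines all adjacencies between and within the classes.
\<close>

lemma loop_triangle_biclique:
  assumes T: "loop_triangle l a b"
  shows "\<exists>X Y. biclique X Y"
proof -
  have T': "adj l l" "\<not> adj a a" "\<not> adj b b" "adj l a" "adj l b" "adj a b"
    "adj a l" "adj b l" "adj b a" "a \<noteq> l" "b \<noteq> l"
    using T adj_sym unfolding loop_triangle_def by blast+
  have nonloop: "\<not> adj c c" if "c \<noteq> l" for c
    using loop_triangle_unique_loop[OF T] that by blast
  define X Y where "X = {x. adj x b}" and "Y = {y. adj y a}"
  have loop: "adj c l" "adj l c" for c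
    using loop_triangle_adj_loop[OF T] nonloop T' adj_sym by metis+
  have one: "x \<in> X \<longleftrightarrow> x \<notin> Y" if "x \<noteq> l" for x
    using loop_triangle_exactly_one[OF T nonloop[OF that]] T' by (auto simp: X_def Y_def)
  have step: "loop_triangle l x b" if "x \<in> X" "x \<noteq> l" for x
    using that T' loop nonloop unfolding loop_triangle_def X_def by blast
  have step': "loop_triangle l y a" if "y \<in> Y" "y \<noteq> l" for y
    using that T' loop nonloop unfolding loop_triangle_def Y_def by blast
  have XX: "\<not> adj x x'" if "x \<in> X" "x' \<in> X" "x \<noteq> l" "x' \<noteq> l" for x x'
    using loop_triangle_exactly_one[OF step[OF that(1,3)] nonloop[OF that(4)]] that nonloop adj_sym T'
    by (auto simp: X_def)
  have YY: "\<not> adj y y'" if "y \<in> Y" "y' \<in> Y" "y \<noteq> l" "y' \<noteq> l" for y y'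
    using loop_triangle_exactly_one[OF step'[OF that(1,3)] nonloop[OF that(4)]] that nonloop adj_sym T'
    by (auto simp: Y_def)
  have XY: "adj x y" if "x \<in> X" "y \<in> Y" "x \<noteq> l" "y \<noteq> l" for x y
  proof (cases "y = b")
    case True
    then show ?thesis using that by (simp add: X_def)
  next
    case False
    have "y \<noteq> x" "\<not> adj y b"
      using that one by (auto simp: X_def)
    then show ?thesis
      using loop_triangle_exactly_one[OF step[OF that(1,3)] nonloop[OF that(4)]] False adj_sym by blast
  qed
  have "adj i j \<longleftrightarrow> (i \<in> X \<and> j \<in> Y) \<or> (i \<in> Y \<and> j \<in> X)" for i j
  proof -
    have l: "l \<in> X" "l \<in> Y"
      using T' by (auto simp: X_def Y_def)
    consider "i = l" | "j = l" | "i \<noteq> l" "j \<noteq> l" by blast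
    then show ?thesis
    proof cases
      case 1
      then show ?thesis using loop l one[of j] by blast
    next
      case 2
      then show ?thesis using loop l one[of i] by blast
    next
      case 3
      then show ?thesis
        using XX[of i j] YY[of i j] XY[of i j] XY[of j i] one[of i] one[of j] adj_sym by blast
    qed
  qed
  moreover have "x \<in> X \<or> x \<in> Y" for x
    using one[of x] T' by (cases "x = l") (auto simp: X_def)
  then have "X \<union> Y = UNIV"
    by blast
  moreover have "z = l" if "z \<in> X" "z \<in> Y" for z
    using one that by blast
  then have "\<forall>z\<in>X \<inter> Y. \<forall>z'\<in>X \<inter> Y. z = z'"
    by blast
  moreover have "a \<in> X" "l \<in> X" "b \<in> Y" "l \<in> Y"
    using T' by (auto simp: X_def Y_def)
  ultimately have "biclique X Y"
    unfolding biclique_def using T' by blast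
  then show ?thesis by blast
qed

text \<open>
  A loop at \<open>n\<close> whose vertex is not adjacent to \<open>w\<close> is joined to the trapezoid.
\<close>

lemma loop_pair_loops_adj:
  assumes T: "loop_pair l m w" and n: "adj n n"
  shows "adj n w"
proof (rule ccontr)
  assume nw: "\<not> adj n w"
  have T': "adj l l" "adj m m" "l \<noteq> m" "\<not> adj w w" "adj l w" "adj m w" "w \<noteq> l"
    using T unfolding loop_pair_def by auto
  then have ne: "n \<noteq> l" "n \<noteq> m"
    using nw by auto
  have "extremal n n"
    using n by (simp add: extremal_def)
  moreover have "joined n n l l" "joined n n m m"
    using joined_loops n T' ne by auto
  moreover have "joined n n l w" "joined n n m w"
    using joined_loop_disjoint n T' nw by auto
  ultimately show False
    using no_trapezoid[of n n l m w] T' by blast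
qed

text \<open>
  Otherwise the point of \<open>{l, c}\<close> is joined to the trapezoid.
\<close>

lemma loop_pair_not_only_first:
  assumes T: "loop_pair l m w" and c: "\<not> adj c c" "c \<noteq> w" "\<not> adj c w" "adj c l"
  shows "adj c m"
proof (rule ccontr)
  assume cm: "\<not> adj c m"
  have T': "adj l l" "adj m m" "l \<noteq> m" "\<not> adj w w" "adj l w" "adj m w" "w \<noteq> l" "adj w m"
    using T adj_sym unfolding loop_pair_def by auto
  have c': "adj l c" "\<not> adj m c"
    using c cm adj_sym by blast+
  show False
  proof (rule no_trapezoid[of l c l m w])
    show "extremal l c"
      using c c' by (auto simp: extremal_def)
    show "joined l c l l"
      using joined_loop_incident[of l c] T' c c' joined_commute(1) by blast
    show "joined l c m m"
      using joined_loop_disjoint[of m c l] T' c c' joined_commute(1) by blast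
    show "joined l c l w"
      using joined_at_common_vertex[of c w l] T' c c' by blast
    have "joined w m c l"
      using joined_disjoint[of c w m l] T' c cm by blast
    then show "joined l c m w"
      using joined_commute by metis
  qed (use T' in auto)
qed

text \<open>
  If \<open>c\<close> is adjacent to \<open>w\<close>, it cannot be adjacent to \<open>l\<close> or \<open>m\<close> without closing a triangle at a
  loop, and then the point of \<open>{w, c}\<close> is joined to the trapezoid. If \<open>c\<close> is adjacent to none of
  \<open>w\<close>, \<open>l\<close> and \<open>m\<close>, the same holds for any edge at \<open>c\<close>.
\<close>

lemma loop_pair_nonloop:
  assumes T: "loop_pair l m w" and c: "\<not> adj c c" "c \<noteq> w"
    and no_triangle: "\<And>l a b. \<not> loop_triangle l a b"
  shows "\<not> adj c w" "adj c l \<and> adj c m"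
proof -
  have T': "adj l l" "adj m m" "l \<noteq> m" "\<not> adj w w" "adj l w" "adj m w" "w \<noteq> l"
    "adj w l" "adj w m"
    using T adj_sym unfolding loop_pair_def by auto
  show cw: "\<not> adj c w"
  proof
    assume cw: "adj c w"
    have wc: "adj w c"
      using cw adj_sym by blast
    have nadj: "\<not> adj l c" "\<not> adj m c"
      using no_triangle T' c cw unfolding loop_triangle_def by blast+
    then have ne: "c \<noteq> l" "c \<noteq> m"
      using T' by auto
    show False
    proof (rule no_trapezoid[of w c l m w])
      show "extremal w c"
        using c wc by (auto simp: extremal_def)
      show "joined w c l l" "joined w c m m"
        using joined_loop_disjoint[of _ c w] T' c wc nadj joined_commute(1) by blast+
      have "joined w c w l" "joined w c w m"
        using joined_at_nonloop T' wc ne by auto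
      then show "joined w c l w" "joined w c m w"
        using joined_commute by metis+
    qed (use T' in auto)
  qed
  have "adj c l \<longleftrightarrow> adj c m"
    using loop_pair_not_only_first[OF T c cw]
      loop_pair_not_only_first[OF loop_pair_swap[OF T] c cw] by blast
  moreover have "adj c l \<or> adj c m"
  proof (rule ccontr)
    assume none: "\<not> (adj c l \<or> adj c m)"
    obtain d where d: "adj c d" "adj d c"
      using no_isolated adj_sym by blast
    have nadj: "\<not> adj l c" "\<not> adj m c"
      using none adj_sym by blast+
    show False
    proof (rule no_trapezoid[of c d l m w])
      show "extremal c d"
        using c d by (auto simp: extremal_def)
      have "joined l l d c" "joined m m d c"
        using joined_loop_disjoint T' c nadj d by blast+
      then show "joined c d l l" "joined c d m m"
        using joined_commute by metis+
      have "joined w l c d" "joined w m c d"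
        using joined_disjoint[OF c(1) cw] none T' d by blast+
      then show "joined c d l w" "joined c d m w"
        using joined_commute by metis+
    qed (use T' in auto)
  qed
  ultimately show "adj c l \<and> adj c m" by blast
qed

text \<open>
  Every loopless vertex can take the place of \<open>w\<close>.
\<close>

lemma loop_pair_truncated:
  assumes T: "loop_pair l m w" and no_triangle: "\<And>l a b. \<not> loop_triangle l a b"
  shows truncated
proof -
  have T': "adj l l" "adj m m" "l \<noteq> m" "\<not> adj w w"
    using T unfolding loop_pair_def by auto
  have pair: "loop_pair l m c" if "\<not> adj c c" for c
    using loop_pair_nonloop(2)[OF T that _ no_triangle] T T' that adj_sym
    unfolding loop_pair_def by blast
  have loop_adj: "adj i j" if "adj i i" for i j
    using loops_adj[OF that] loop_pair_loops_adj[OF pair that] by blast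
  have nonloop: "\<not> adj i j" if "\<not> adj i i" "\<not> adj j j" for i j
    using loop_pair_nonloop(1)[OF pair[OF that(2)] that(1) _ no_triangle] that by blast
  have "adj i j \<longleftrightarrow> adj i i \<or> adj j j" for i j
    using loop_adj nonloop adj_sym by blast
  then show ?thesis
    unfolding truncated_def using T' by blast
qed

theorem biclique_or_truncated:
  assumes nonsimplex: "\<not> is_simplex P"
  shows "(\<exists>X Y. biclique X Y) \<or> truncated"
proof (cases "\<exists>l. adj l l")
  case False
  then show ?thesis
    using loopless_biclique nonsimplex by blast
next
  case True
  then show ?thesis
    using loop_configuration_exists[OF nonsimplex] loop_triangle_biclique loop_pair_truncated by blast
qed

end

section \<open>Characterisation of simple and smooth edge polytopes\<close>

context looped_graph
begin

theorem simple_iff: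
  "simple_polytope P \<and> \<not> is_simplex P \<longleftrightarrow> (\<exists>X Y. biclique X Y) \<or> truncated"
proof
  assume P: "simple_polytope P \<and> \<not> is_simplex P"
  then interpret simple_edge_polytope adj
    by unfold_locales simp
  show "(\<exists>X Y. biclique X Y) \<or> truncated"
    using P biclique_or_truncated by blast
next
  assume "(\<exists>X Y. biclique X Y) \<or> truncated"
  then show "simple_polytope P \<and> \<not> is_simplex P"
    using biclique_smooth biclique_not_simplex truncated_smooth truncated_not_simplex
    unfolding smooth_polytope_def by blast
qed

theorem smooth_iff:
  "smooth_polytope P \<and> \<not> is_simplex P \<longleftrightarrow> (\<exists>X Y. biclique X Y) \<or> truncated"
proof
  assume "smooth_polytope P \<and> \<not> is_simplex P"
  then show "(\<exists>X Y. biclique X Y) \<or> truncated"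
    using simple_iff unfolding smooth_polytope_def by blast
next
  assume "(\<exists>X Y. biclique X Y) \<or> truncated"
  then show "smooth_polytope P \<and> \<not> is_simplex P"
    using biclique_smooth biclique_not_simplex truncated_smooth truncated_not_simplex by blast
qed

end

lemma is_cycle_4_iff:
  "is_cycle E [a, b, c, d] \<longleftrightarrow>
    distinct [a, b, c, d] \<and> {a, b} \<in> E \<and> {b, c} \<in> E \<and> {c, d} \<in> E \<and> {d, a} \<in> E"
proof -
  have four: "(\<forall>k<4. Q k) \<longleftrightarrow> Q 0 \<and> Q 1 \<and> Q 2 \<and> Q 3" for Q :: "nat \<Rightarrow> bool"
  proof
    assume Q: "Q 0 \<and> Q 1 \<and> Q 2 \<and> Q 3"
    show "\<forall>k<4. Q k"
    proof (intro allI impI)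
      fix k :: nat assume "k < 4"
      then have "k = 0 \<or> k = 1 \<or> k = 2 \<or> k = 3" by linarith
      then show "Q k" using Q by blast
    qed
  qed simp
  have len: "length [a, b, c, d] = 4" by simp
  show ?thesis
    unfolding is_cycle_def len four by simp
qed

lemma mem_induced_edges_iff: "{i, j} \<in> induced_edges E U \<longleftrightarrow> {i, j} \<in> E \<and> i \<in> U \<and> j \<in> U"
  by (auto simp: induced_edges_def doubleton_eq_iff insert_commute)

text \<open>
  Translation between adjacency and sets of edges. A \<open>4\<close>-cycle of a bipartite graph gives two
  elements on either side, and in case \<open>(\<beta>)\<close> the looped vertex is added to both classes.
\<close>

theorem theorem1p8:
  fixes E :: "'n::finite set set" and W :: "'n set" and E' :: "'n set set"
  assumes edges: "\<forall>e\<in>E. \<exists>i j. e = {i, j}"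
    and no_isolated_vertex: "\<forall>i. \<exists>j. {i, j} \<in> E"
    and loop_condition: "\<forall>i j. {i, i} \<in> E \<and> {j, j} \<in> E \<longrightarrow> {i, j} \<in> E"
    and W_def: "W = {i. {i, i} \<notin> E}"
    and E'_def: "E' = induced_edges E W"
  defines "cond_i \<equiv> simple_polytope (edge_polytope E) \<and> \<not> is_simplex (edge_polytope E)"
    and "cond_ii \<equiv> smooth_polytope (edge_polytope E) \<and> \<not> is_simplex (edge_polytope E)"
    and "cond_iii \<equiv> W \<noteq> {} \<and>
      (complete_bipartite UNIV E \<and> (\<exists>c. is_cycle E c \<and> length c = 4)
       \<or> card {i. {i, i} \<in> E} = 1 \<and> complete_bipartite W E' \<and>
         (\<forall>i. {i, i} \<in> E \<longrightarrow> (\<forall>j\<in>W. {i, j} \<in> E))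
       \<or> 2 \<le> card {i. {i, i} \<in> E} \<and> E' = {} \<and>
         (\<forall>i. {i, i} \<in> E \<longrightarrow> (\<forall>j\<in>W. {i, j} \<in> E)))"
  shows "(cond_i \<longleftrightarrow> cond_ii) \<and> (cond_ii \<longleftrightarrow> cond_iii)"
proof -
  define adj where "adj i j \<longleftrightarrow> {i, j} \<in> E" for i j
  have adj_sym: "adj i j \<Longrightarrow> adj j i" for i j
    by (simp add: adj_def insert_commute)
  interpret looped_graph adj
    using no_isolated_vertex loop_condition adj_sym by unfold_locales (auto simp: adj_def)
  have P: "edge_polytope E = P"
    by (simp add: edge_polytope_def edge_points_def edge_point_def adj_def)
  have W: "i \<in> W \<longleftrightarrow> \<not> adj i i" for i
    by (simp add: W_def adj_def)
  have E': "{i, j} \<in> E' \<longleftrightarrow> adj i j \<and> i \<in> W \<and> j \<in> W" for i j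
    unfolding E'_def mem_induced_edges_iff adj_def ..
  have E'_elim: "\<exists>i j. e = {i, j} \<and> adj i j \<and> i \<in> W \<and> j \<in> W" if "e \<in> E'" for e
    using that unfolding E'_def induced_edges_def adj_def by blast
  have edge_elim: "\<exists>i j. e = {i, j} \<and> adj i j" if "e \<in> E" for e
  proof -
    have "\<exists>i j. e = {i, j}"
      using edges that by (rule bspec)
    with that show ?thesis
      unfolding adj_def by metis
  qed
  define \<alpha> where "\<alpha> \<longleftrightarrow> complete_bipartite UNIV E \<and> (\<exists>c. is_cycle E c \<and> length c = 4)"
  define \<beta> where "\<beta> \<longleftrightarrow> card {i. adj i i} = 1 \<and> complete_bipartite W E' \<and>
    (\<forall>i. adj i i \<longrightarrow> (\<forall>j\<in>W. adj i j))"
  define \<gamma> where "\<gamma> \<longleftrightarrow> 2 \<le> card {i. adj i i} \<and> E' = {} \<and> (\<forall>i. adj i i \<longrightarrow> (\<forall>j\<in>W. adj i j))"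
  have iii: "cond_iii \<longleftrightarrow> W \<noteq> {} \<and> (\<alpha> \<or> \<beta> \<or> \<gamma>)"
    unfolding cond_iii_def \<alpha>_def \<beta>_def \<gamma>_def adj_def ..

  have biclique_if_\<alpha>: "\<exists>X Y. biclique X Y" if \<alpha>
  proof -
    have "complete_bipartite UNIV E"
      using \<open>\<alpha>\<close> unfolding \<alpha>_def by (rule conjunct1)
    then obtain X Y where XY: "X \<union> Y = UNIV" "X \<inter> Y = {}"
      "\<forall>e\<in>E. \<exists>i\<in>X. \<exists>j\<in>Y. e = {i, j}" "\<forall>i\<in>X. \<forall>j\<in>Y. {i, j} \<in> E"
      unfolding complete_bipartite_def by metis
    have adj_iff: "adj i j \<longleftrightarrow> (i \<in> X \<and> j \<in> Y) \<or> (i \<in> Y \<and> j \<in> X)" for i j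
    proof
      assume "adj i j"
      then have "\<exists>x\<in>X. \<exists>y\<in>Y. {i, j} = {x, y}"
        using XY(3) unfolding adj_def by (rule bspec[rotated])
      then show "(i \<in> X \<and> j \<in> Y) \<or> (i \<in> Y \<and> j \<in> X)"
        unfolding doubleton_eq_iff by blast
    next
      assume "(i \<in> X \<and> j \<in> Y) \<or> (i \<in> Y \<and> j \<in> X)"
      then show "adj i j"
        using XY(4) adj_sym unfolding adj_def by blast
    qed
    obtain vs where "is_cycle E vs" "length vs = 4"
      using \<open>\<alpha>\<close> unfolding \<alpha>_def by blast
    then obtain a b c d where "is_cycle E [a, b, c, d]"
      by (auto simp: numeral_eq_Suc length_Suc_conv)
    then have cyc: "a \<noteq> c" "b \<noteq> d" "adj a b" "adj b c" "adj c d" "adj d a"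
      unfolding is_cycle_4_iff adj_def by auto
    then have "a \<in> X \<and> c \<in> X \<and> b \<in> Y \<and> d \<in> Y \<or> a \<in> Y \<and> c \<in> Y \<and> b \<in> X \<and> d \<in> X"
      using XY(1,2) unfolding adj_iff by blast
    then have "biclique X Y"
      unfolding biclique_def using XY(1,2) adj_iff cyc(1,2) by blast
    then show ?thesis by blast
  qed

  have biclique_if_\<beta>: "\<exists>X Y. biclique X Y" if \<beta>
  proof -
    obtain l where l: "{i. adj i i} = {l}"
      using \<open>\<beta>\<close> unfolding \<beta>_def by (auto simp: card_1_singleton_iff)
    have "complete_bipartite W E'"
      using \<open>\<beta>\<close> unfolding \<beta>_def by (elim conjE)
    then obtain X Y where XY: "X \<union> Y = W" "X \<inter> Y = {}" "X \<noteq> {}" "Y \<noteq> {}"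
      "\<forall>e\<in>E'. \<exists>i\<in>X. \<exists>j\<in>Y. e = {i, j}" "\<forall>i\<in>X. \<forall>j\<in>Y. {i, j} \<in> E'"
      unfolding complete_bipartite_def by metis
    have W_l: "i \<in> W \<longleftrightarrow> i \<noteq> l" for i
      using W l by blast
    have inner: "adj i j \<longleftrightarrow> (i \<in> X \<and> j \<in> Y) \<or> (i \<in> Y \<and> j \<in> X)" if "i \<noteq> l" "j \<noteq> l" for i j
    proof
      assume "adj i j"
      then have "{i, j} \<in> E'"
        using that W_l E' by blast
      then show "(i \<in> X \<and> j \<in> Y) \<or> (i \<in> Y \<and> j \<in> X)"
        using bspec[OF XY(5), of "{i, j}"] unfolding doubleton_eq_iff by blast
    next
      assume "(i \<in> X \<and> j \<in> Y) \<or> (i \<in> Y \<and> j \<in> X)"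
      then have "{i, j} \<in> E' \<or> {j, i} \<in> E'"
        using XY(6) by blast
      then show "adj i j"
        unfolding E' using adj_sym[of j i] by blast
    qed
    have "\<forall>i. adj i i \<longrightarrow> (\<forall>j\<in>W. adj i j)"
      using \<open>\<beta>\<close> unfolding \<beta>_def by (elim conjE)
    moreover have "adj l l"
      using l by blast
    ultimately have "adj l j" for j
      using W_l[of j] by (cases "j = l") auto
    then have loop: "adj l j" "adj j l" for j
      using adj_sym by blast+
    have cover: "i \<in> X \<or> i \<in> Y \<longleftrightarrow> i \<noteq> l" for i
      using XY(1) W_l by blast
    obtain x y where "x \<in> X" "y \<in> Y"
      using XY(3,4) by blast
    have "biclique (insert l X) (insert l Y)"
    proof (rule bicliqueI)
      show "insert l X \<union> insert l Y = UNIV"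
        using cover by blast
      show "z = z'" if "z \<in> insert l X \<inter> insert l Y" "z' \<in> insert l X \<inter> insert l Y" for z z'
        using that XY(2) by blast
      show "x \<in> insert l X" "l \<in> insert l X" "x \<noteq> l" "y \<in> insert l Y" "l \<in> insert l Y" "y \<noteq> l"
        using \<open>x \<in> X\<close> \<open>y \<in> Y\<close> cover by blast+
      show "adj i j \<longleftrightarrow> (i \<in> insert l X \<and> j \<in> insert l Y) \<or> (i \<in> insert l Y \<and> j \<in> insert l X)"
        for i j
        using loop cover[of i] cover[of j] inner[of i j] by (cases "i = l"; cases "j = l") auto
    qed
    then show ?thesis by blast
  qed

  have truncated_if_\<gamma>: truncated if \<gamma> "W \<noteq> {}"
  proof -
    have "\<not> adj i j" if "\<not> adj i i" "\<not> adj j j" for i j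
      using \<open>\<gamma>\<close> that E' W unfolding \<gamma>_def by blast
    moreover have "adj i j" if "adj i i" for i j
      using \<open>\<gamma>\<close> that W loops_adj unfolding \<gamma>_def by blast
    ultimately have "adj i j \<longleftrightarrow> adj i i \<or> adj j j" for i j
      using adj_sym by blast
    moreover have "\<exists>l m. adj l l \<and> adj m m \<and> l \<noteq> m"
    proof (rule ccontr)
      assume "\<nexists>l m. adj l l \<and> adj m m \<and> l \<noteq> m"
      then have "card {i. adj i i} \<le> Suc 0"
        by (subst card_le_Suc0_iff_eq) auto
      with \<open>\<gamma>\<close> show False
        unfolding \<gamma>_def by linarith
    qed
    moreover have "\<exists>w. \<not> adj w w"
      using \<open>W \<noteq> {}\<close> W by blast
    ultimately show ?thesis
      unfolding truncated_def by blast
  qed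

  have \<alpha>_or_\<beta>_if_biclique: "W \<noteq> {} \<and> (\<alpha> \<or> \<beta>)" if XY: "biclique X Y" for X Y
  proof -
    have adj_iff: "adj i j \<longleftrightarrow> (i \<in> X \<and> j \<in> Y) \<or> (i \<in> Y \<and> j \<in> X)" for i j
      using XY unfolding biclique_def by blast
    have cover: "X \<union> Y = UNIV"
      using XY unfolding biclique_def by blast
    obtain x x' y y' where xy: "x \<in> X" "x' \<in> X" "x \<noteq> x'" "y \<in> Y" "y' \<in> Y" "y \<noteq> y'"
      using XY unfolding biclique_def by blast
    have loops: "{i. adj i i} = X \<inter> Y"
      using adj_iff by blast
    show ?thesis
    proof (cases "X \<inter> Y = {}")
      case True
      have "\<exists>i\<in>X. \<exists>j\<in>Y. e = {i, j}" if e: "e \<in> E" for e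
        using edge_elim[OF e] unfolding adj_iff by (auto simp: insert_commute)
      moreover have "{i, j} \<in> E" if "i \<in> X" "j \<in> Y" for i j
        using that adj_iff[of i j] by (simp add: adj_def)
      ultimately have "complete_bipartite UNIV E"
        unfolding complete_bipartite_def using cover True xy by blast
      moreover have "is_cycle E [x, y, x', y']"
        using xy True adj_iff unfolding is_cycle_4_iff adj_def by auto
      then have "\<exists>c. is_cycle E c \<and> length c = 4"
        by (intro exI[of _ "[x, y, x', y']"]) simp
      moreover have "W \<noteq> {}"
        using W loops True by blast
      ultimately show ?thesis
        unfolding \<alpha>_def by blast
    next
      case False
      then obtain l where "l \<in> X \<inter> Y"
        by blast
      moreover have "\<forall>z\<in>X \<inter> Y. \<forall>z'\<in>X \<inter> Y. z = z'"
        using XY unfolding biclique_def by (elim conjE)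
      ultimately have l: "X \<inter> Y = {l}"
        by blast
      have W_l: "W = UNIV - {l}"
        using W loops l by blast
      have "\<exists>i\<in>X - {l}. \<exists>j\<in>Y - {l}. e = {i, j}" if e: "e \<in> E'" for e
        using E'_elim[OF e] W_l unfolding adj_iff by (auto simp: insert_commute)
      moreover have "{i, j} \<in> E'" if "i \<in> X - {l}" "j \<in> Y - {l}" for i j
        using that E' W_l adj_iff by blast
      moreover have "X - {l} \<noteq> {}" "Y - {l} \<noteq> {}"
        using xy by blast+
      moreover have "(X - {l}) \<union> (Y - {l}) = W" "(X - {l}) \<inter> (Y - {l}) = {}"
        using W_l cover l by blast+
      ultimately have "complete_bipartite W E'"
        unfolding complete_bipartite_def by blast
      moreover have "card {i. adj i i} = 1"
        unfolding loops l by simp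
      moreover have "\<forall>i. adj i i \<longrightarrow> (\<forall>j\<in>W. adj i j)"
        using adj_iff cover by blast
      moreover have "x \<in> W \<or> x' \<in> W"
        using xy(3) unfolding W_l by blast
      then have "W \<noteq> {}"
        by blast
      ultimately show ?thesis
        unfolding \<beta>_def by blast
    qed
  qed

  have \<gamma>_if_truncated: "W \<noteq> {} \<and> \<gamma>" if truncated
  proof -
    obtain l m w where lmw: "adj l l" "adj m m" "l \<noteq> m" "\<not> adj w w"
      using \<open>truncated\<close> unfolding truncated_def by blast
    have adj_iff: "adj i j \<longleftrightarrow> adj i i \<or> adj j j" for i j
      using \<open>truncated\<close> unfolding truncated_def by blast
    have "card {l, m} \<le> card {i. adj i i}"
      using lmw by (intro card_mono) auto
    then have "2 \<le> card {i. adj i i}"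
      using lmw by simp
    moreover have "E' = {}"
      using E'_elim W adj_iff by blast
    moreover have "\<forall>i. adj i i \<longrightarrow> (\<forall>j\<in>W. adj i j)"
      using adj_iff by blast
    moreover have "W \<noteq> {}"
      using lmw W by blast
    ultimately show ?thesis
      unfolding \<gamma>_def by blast
  qed

  have "cond_iii \<longleftrightarrow> (\<exists>X Y. biclique X Y) \<or> truncated"
    unfolding iii using biclique_if_\<alpha> biclique_if_\<beta> truncated_if_\<gamma> \<alpha>_or_\<beta>_if_biclique \<gamma>_if_truncated
    by blast
  then show ?thesis
    unfolding cond_i_def cond_ii_def P simple_iff smooth_iff by blast
qed

end
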